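(* Let $n\ge2$ and let $\mathcal{M}=\partial D\subset\mathbb{R}^n$ be the boundary of a bounded domain $D$, strictly starlike with respect to the origin, which satisfies the $\alpha$-tangent condition for some $\alpha\in(0,\pi/2]$. Let $f_{\mathcal{M}}:\overline{\mathbb{R}}^n\to\overline{\mathbb{R}}^n$ be the quasi-inversion in $\mathcal{M}$. Then $f_{\mathcal{M}}$ is an $L^6$-bi-Lipschitz map with respect to the chordal metric $q$, where $$L=\max\left\{\frac{r_{\max}}{2},\frac{1}{2r_{\min}}\right\}\left(\sqrt{\csc^2\alpha-1}+\sqrt{\csc^2\alpha+3}\right),\qquad r_{\max}=\max_{w\in\mathcal{M}}|w|,\quad r_{\min}=\min_{w\in\mathcal{M}}|w|.$$ Moreover, if $\mathcal{M}_t$, $t\in[0,1]$, is a family of surfaces smoothly converging to the unit sphere $S^{n-1}$ as $t\to0$, then the bi-Lipschitz constants $L_t$ (with respect to $q$) of the quasi-inversions $f_{\mathcal{M}_t}$ tend to $1$ as $t\to0$.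
   Context: $\overline{\mathbb{R}}^n=\mathbb{R}^n\cup\{\infty\}$, $S^{n-1}$ is the unit sphere, $S^{n-1}(r)$ the sphere of radius $r$ centered at $0$. A bounded domain $D\subset\mathbb{R}^n$ is strictly starlike with respect to the point $a$ if each ray emanating from $a$ meets $\partial D$ at exactly one point (in particular $a\in D$). Quasi-inversion: for $x\in\mathbb{R}^n\setminus\{0\}$ let $r_x=|w|$, where $w$ is the unique point of $\{tx:t>0\}\cap\mathcal{M}$. Then $f_{\mathcal{M}}(x)=\frac{r_x^2}{|x|^2}x$ for $x\in\mathbb{R}^n\setminus\{0\}$, $f_{\mathcal{M}}(0)=\infty$, $f_{\mathcal{M}}(\infty)=0$. Tangent condition: for $x,z\in\partial D$, $z\ne x$, let $\alpha(z,x)\in[0,\pi/2]$ be the acute angle which the segment $[z,x]$ makes with the ray from $0$ through $x$, i.e. $\cos\alpha(z,x)=\frac{|\langle z-x,x\rangle|}{|z-x||x|}$, and put $\alpha(x)=\liminf_{z\to x,\,z\in\partial D}\alpha(z,x)$. $D$ (and $\partial D$) satisfies the $\alpha$-tangent condition if $\alpha(x)\ge\alpha$ for every $x\in\partial D$. Chordal metric: $q(x,y)=\frac{|x-y|}{\sqrt{1+|x|^2}\sqrt{1+|y|^2}}$ for $x,y\ne\infty$, and $q(x,\infty)=\frac{1}{\sqrt{1+|x|^2}}$ for $x\neq\infty$. A homeomorphism $f$ is $C$-bi-Lipschitz with respect to a metric $d$ if $d(x,y)/C\le d(f(x),f(y))\le C\,d(x,y)$ for all $x,y$; the bi-Lipschitz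 constant is the smallest such $C$. Smooth convergence: for $t\in[0,1]$ let $\mathcal{M}_t$ be the boundary of a bounded domain strictly starlike with respect to $0$ which satisfies the $\alpha_{\mathcal{M}_t}$-tangent condition, and let $\varphi_t:\mathbb{R}^n\to\mathbb{R}^n$ be the radial extension which sends the unit sphere to $\mathcal{M}_t$, i.e. $\varphi_t(0)=0$ and, for $x\ne0$, $\varphi_t(x)=|x|\,\varphi^{(t)}(x/|x|)$, where $\varphi^{(t)}(u)$ is the unique point of $\mathcal{M}_t$ on the ray from $0$ through $u\in S^{n-1}$. $\mathcal{M}_t$ smoothly converges to $S^{n-1}(r)$ as $t\to0$ if $\lim_{t\to0}\operatorname{ess\,sup}_{|x|=1}|\varphi_t'(x)-r\mathbf{I}|=0$, where $\mathbf{I}$ is the identity matrix and $|\cdot|$ the operator norm (this in particular means $\alpha_{\mathcal{M}_t}\to\pi/2$). *)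

theory Defs
  imports "HOL-Analysis.Analysis" "HOL-Probability.Essential_Supremum"
begin

text \<open>The extended space is \<open>'a option\<close>, with \<open>None\<close> as the point at infinity.\<close>

fun chordal :: "'a::euclidean_space option \<Rightarrow> 'a option \<Rightarrow> real" where
  "chordal (Some x) (Some y) =
     norm (x - y) / (sqrt (1 + (norm x)\<^sup>2) * sqrt (1 + (norm y)\<^sup>2))"
| "chordal (Some x) None = 1 / sqrt (1 + (norm x)\<^sup>2)"
| "chordal None (Some y) = 1 / sqrt (1 + (norm y)\<^sup>2)"
| "chordal None None = 0"

text \<open>The metric \<open>d\<close> is a metric on the whole type. Continuity refers to the topology it induces;
  for \<open>chordal\<close> this is the topology of the one-point compactification.\<close>

definition bilipschitz :: "('a \<Rightarrow> 'a \<Rightarrow> real) \<Rightarrow> real \<Rightarrow> ('a \<Rightarrow> 'a) \<Rightarrow> bool" where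
  "bilipschitz d C f \<longleftrightarrow>
     homeomorphic_map (Metric_space.mtopology UNIV d) (Metric_space.mtopology UNIV d) f \<and>
     0 < C \<and> (\<forall>x y. d x y / C \<le> d (f x) (f y) \<and> d (f x) (f y) \<le> C * d x y)"

definition bilipschitz_const :: "('a \<Rightarrow> 'a \<Rightarrow> real) \<Rightarrow> ('a \<Rightarrow> 'a) \<Rightarrow> real" where
  "bilipschitz_const d f = (LEAST C. bilipschitz d C f)"

definition strictly_starlike :: "'a::euclidean_space set \<Rightarrow> 'a \<Rightarrow> bool" where
  "strictly_starlike D a \<longleftrightarrow>
     open D \<and> connected D \<and> bounded D \<and> a \<in> D \<and>
     (\<forall>u. u \<noteq> 0 \<longrightarrow> (\<exists>!w. w \<in> frontier D \<and> (\<exists>t>0. w = a + t *\<^sub>R u)))"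

definition tangent_angle :: "'a::euclidean_space \<Rightarrow> 'a \<Rightarrow> real" where
  "tangent_angle z x = arccos (\<bar>(z - x) \<bullet> x\<bar> / (norm (z - x) * norm x))"

text \<open>The lower limit is taken in \<open>ereal\<close>; \<open>at x within M\<close> excludes the point \<open>x\<close> itself.\<close>

definition tangent_condition :: "real \<Rightarrow> 'a::euclidean_space set \<Rightarrow> bool" where
  "tangent_condition \<alpha> M \<longleftrightarrow>
     (\<forall>x\<in>M. ereal \<alpha> \<le> Liminf (at x within M) (\<lambda>z. ereal (tangent_angle z x)))"

definition radial_point :: "'a::euclidean_space set \<Rightarrow> 'a \<Rightarrow> 'a" where
  "radial_point M x = (THE w. w \<in> M \<and> (\<exists>t>0. w = t *\<^sub>R x))"

fun quasi_inversion :: "'a::euclidean_space set \<Rightarrow> 'a option \<Rightarrow> 'a option" where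
  "quasi_inversion M None = Some 0"
| "quasi_inversion M (Some x) =
     (if x = 0 then None
      else Some (((norm (radial_point M x))\<^sup>2 / (norm x)\<^sup>2) *\<^sub>R x))"

definition radial_extension :: "'a::euclidean_space set \<Rightarrow> 'a \<Rightarrow> 'a" where
  "radial_extension M x =
     (if x = 0 then 0 else norm x *\<^sub>R radial_point M (x /\<^sub>R norm x))"

text \<open>Surface measure on the unit sphere, by the cone formula: \<open>\<sigma>(A)\<close> is \<open>n\<close> times the
  \<open>n\<close>-dimensional Lebesgue measure of \<open>{t u | 0 < t \<le> 1, u \<in> A}\<close>.\<close>

definition sphere_measure :: "'a::euclidean_space measure" where
  "sphere_measure =
     scale_measure (of_nat DIM('a))
       (distr (restrict_space lborel (cball 0 1 - {0})) (restrict_space borel (sphere 0 1))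
          (\<lambda>x. x /\<^sub>R norm x))"

text \<open>The operator norm of \<open>\<phi>'(x) - r I\<close>. Since \<open>frechet_derivative\<close> is arbitrary where \<open>\<phi>\<close> is not
  differentiable, the value there is set to \<open>\<infinity>\<close>. Hence the essential supremum below is finite only
  if \<open>\<phi>\<close> is differentiable almost everywhere on the sphere, which holds for the (Lipschitz) radial
  extensions considered. The function is Borel measurable for continuous \<open>\<phi>\<close>, so that the
  convention of \<open>esssup\<close> for non-measurable functions does not come into play.\<close>

definition deriv_deviation :: "('a::euclidean_space \<Rightarrow> 'a) \<Rightarrow> real \<Rightarrow> 'a \<Rightarrow> ereal" where
  "deriv_deviation \<phi> r x =
     (if \<phi> differentiable (at x)
      then ereal (onorm (\<lambda>v. frechet_derivative \<phi> (at x) v - r *\<^sub>R v))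
      else \<infinity>)"

definition smoothly_converges :: "(real \<Rightarrow> 'a::euclidean_space set) \<Rightarrow> real \<Rightarrow> bool" where
  "smoothly_converges M r \<longleftrightarrow>
     (\<forall>t\<in>{0..1}. \<exists>D \<alpha>. strictly_starlike D 0 \<and> M t = frontier D \<and>
        0 < \<alpha> \<and> \<alpha> \<le> pi / 2 \<and> tangent_condition \<alpha> (M t)) \<and>
     ((\<lambda>t. esssup sphere_measure (deriv_deviation (radial_extension (M t)) r)) \<longlongrightarrow> 0)
       (at 0 within {0..1})"

end

theory Submission
  imports Defs
begin

text \<open>
  Write \<open>\<rho>(x) = norm (radial_point M x)\<close>, a continuous function of the direction of \<open>x\<close>. The radial
  extension is \<open>\<phi>(x) = \<rho>(x) x\<close>, its inverse is \<open>y \<mapsto> y / \<rho>(y)\<close>, and the quasi-inversion is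
  \<open>\<phi> \<circ> J \<circ> \<phi>\<^sup>-\<^sup>1\<close>, where \<open>J(x) = x / \<bar>x\<bar>\<^sup>2\<close> is a chordal isometry. If \<open>\<phi>\<close> is \<open>C\<close>-bi-Lipschitz for the Euclidean
  metric then, as \<open>\<phi>(0) = 0\<close>, it is \<open>C\<^sup>3\<close>-bi-Lipschitz for the chordal metric, so the quasi-inversion is
  \<open>C\<^sup>6\<close>-bi-Lipschitz (\<open>quasi_inversion_bilipschitz\<close>). Both claims are reduced to Euclidean bounds for \<open>\<phi>\<close>.

  For the first claim, put \<open>k = cot \<alpha>\<close>. The tangent condition says that infinitesimally \<open>\<rho>\<close> changes by at most
  \<open>k \<rho>(x) / \<bar>x\<bar>\<close> times the component of the displacement orthogonal to \<open>x\<close>, and \<open>1 / \<rho>\<close> inherits the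
  bound with the same \<open>k\<close>. Infinitesimally \<open>\<phi>\<close> is therefore \<open>\<rho>(x)\<close> times a shear of strength at most \<open>k\<close>,
  whose norm is at most \<open>\<sigma>(k) = (k + sqrt (k\<^sup>2 + 4)) / 2\<close>. This estimate holds at every point, so no
  differentiability is needed, and it integrates to Lipschitz constants \<open>r_max \<sigma>(k)\<close> for \<open>\<phi>\<close> and \<open>\<sigma>(k) / r_min\<close>
  for the inverse (\<open>radial_extension_bilipschitz\<close>); the larger of the two is \<open>L\<close>.

  For the second claim, the essential supremum only controls \<open>\<phi>' - I\<close> almost everywhere on the sphere.
  By homogeneity the control holds almost everywhere in the unit ball. Since \<open>\<phi>\<close> is already known to
  be Lipschitz, \<open>lipschitz_on_AE_pointwise\<close> turns this into the statement that \<open>\<phi> - id\<close> is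
  \<open>\<epsilon>\<close>-Lipschitz. Hence \<open>\<phi>\<close> is \<open>1 / (1 - \<epsilon>)\<close>-bi-Lipschitz, and the best constant of the
  quasi-inversion lies between \<open>1\<close> and \<open>(1 / (1 - \<epsilon>))\<^sup>6\<close>.
\<close>

section \<open>From infinitesimal to global Lipschitz bounds\<close>

text \<open>The upper limit of the difference quotient at \<open>x\<close> is at most \<open>B\<close>. Quantifying over \<open>C > B\<close> avoids
  an extended real upper limit.\<close>

definition pointwise_lipschitz ::
  "real \<Rightarrow> ('a::real_normed_vector \<Rightarrow> 'b::real_normed_vector) \<Rightarrow> 'a \<Rightarrow> bool" where
  "pointwise_lipschitz B f x \<longleftrightarrow>
     (\<forall>C>B. eventually (\<lambda>y. norm (f y - f x) \<le> C * norm (y - x)) (at x))"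

lemma pointwise_lipschitzD:
  assumes "pointwise_lipschitz B f x" "B < C"
  obtains d where "d > 0" "\<And>y. norm (y - x) < d \<Longrightarrow> norm (f y - f x) \<le> C * norm (y - x)"
proof -
  obtain d where "d > 0" "\<forall>y. y \<noteq> x \<and> dist y x < d \<longrightarrow> norm (f y - f x) \<le> C * norm (y - x)"
    using assms unfolding pointwise_lipschitz_def eventually_at by auto
  then show ?thesis
    by (intro that[of d]) (metis diff_self dist_norm mult_zero_right norm_zero order_refl)+
qed

lemma pointwise_lipschitzI:
  assumes "\<And>C. B < C \<Longrightarrow> \<exists>d>0. \<forall>y. norm (y - x) < d \<longrightarrow> norm (f y - f x) \<le> C * norm (y - x)"
  shows "pointwise_lipschitz B f x"
  unfolding pointwise_lipschitz_def eventually_at dist_norm using assms by meson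

lemma pointwise_lipschitz_mono:
  "pointwise_lipschitz B f x \<Longrightarrow> B \<le> C \<Longrightarrow> pointwise_lipschitz C f x"
  unfolding pointwise_lipschitz_def by auto

lemma lipschitz_on_imp_pointwise_lipschitz:
  assumes "K-lipschitz_on UNIV f"
  shows "pointwise_lipschitz K f x"
proof (rule pointwise_lipschitzI)
  fix C assume "K < C"
  have "norm (f y - f x) \<le> C * norm (y - x)" for y
    using lipschitz_onD[OF assms, of y x] \<open>K < C\<close>
    by (simp add: dist_norm) (meson less_imp_le mult_right_mono norm_ge_zero order_trans)
  then show "\<exists>d>0. \<forall>y. norm (y - x) < d \<longrightarrow> norm (f y - f x) \<le> C * norm (y - x)"
    by (intro exI[of _ 1]) auto
qed

lemma pointwise_lipschitz_along_line:
  assumes "pointwise_lipschitz B f (a + s *\<^sub>R v)"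
  shows "pointwise_lipschitz (B * norm v) (\<lambda>s. f (a + s *\<^sub>R v)) s"
proof (rule pointwise_lipschitzI)
  fix C assume C: "B * norm v < C"
  show "\<exists>d>0. \<forall>t. norm (t - s) < d \<longrightarrow>
          norm (f (a + t *\<^sub>R v) - f (a + s *\<^sub>R v)) \<le> C * norm (t - s)"
  proof (cases "v = 0")
    case True
    then show ?thesis using C by (intro exI[of _ 1]) auto
  next
    case False
    then have "B < C / norm v" using C by (simp add: pos_less_divide_eq)
    then obtain d where d: "d > 0" "\<And>y. norm (y - (a + s *\<^sub>R v)) < d \<Longrightarrow>
        norm (f y - f (a + s *\<^sub>R v)) \<le> C / norm v * norm (y - (a + s *\<^sub>R v))"
      using pointwise_lipschitzD[OF assms] by blast
    have eq: "norm (a + t *\<^sub>R v - (a + s *\<^sub>R v)) = norm (t - s) * norm v" for t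
      by (simp add: scaleR_diff_left[symmetric])
    show ?thesis
    proof (intro exI[of _ "d / norm v"] conjI allI impI)
      show "d / norm v > 0" using d False by simp
      fix t assume "norm (t - s) < d / norm v"
      then have "norm (a + t *\<^sub>R v - (a + s *\<^sub>R v)) < d"
        unfolding eq using False by (simp add: pos_less_divide_eq)
      from d(2)[OF this] show "norm (f (a + t *\<^sub>R v) - f (a + s *\<^sub>R v)) \<le> C * norm (t - s)"
        unfolding eq using False by simp
    qed
  qed
qed

text \<open>The mean value inequality with an exceptional open set \<open>U\<close>, on which only the weaker bound \<open>K\<close>
  is known. Over an interval contained in \<open>U\<close>, the bound \<open>K\<close> times its length is paid for by the
  measure of \<open>U\<close>. With \<open>U = {}\<close> it is the usual mean value inequality.\<close>

lemma increment_bound_exceptional_open: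
  fixes f :: "real \<Rightarrow> 'b::real_normed_vector"
  assumes ab: "a \<le> b" and U: "open U" "emeasure lborel U < \<infinity>" and nn: "0 \<le> B" "0 \<le> K"
    and off: "\<And>x. x \<in> {a..b} \<Longrightarrow> x \<notin> U \<Longrightarrow> pointwise_lipschitz B f x"
    and on: "\<And>x. x \<in> {a..b} \<Longrightarrow> x \<in> U \<Longrightarrow> pointwise_lipschitz K f x"
  shows "norm (f b - f a) \<le> B * (b - a) + K * measure lborel U"
proof -
  define m where "m s t = measure lborel (U \<inter> {s<..t})" for s t
  have Um: "U \<in> sets lborel" using U by simp
  have fm: "U \<inter> {s<..t} \<in> fmeasurable lborel" for s t
    by (rule fmeasurableI2[of "U"]) (use U Um in \<open>auto simp: fmeasurable_def\<close>)
  have mle: "m s t \<le> measure lborel U" for s t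
    unfolding m_def by (rule measure_mono_fmeasurable) (use U Um in \<open>auto simp: fmeasurable_def\<close>)
  have m0: "m s t \<ge> 0" for s t by (simp add: m_def)
  have madd: "m s r = m s t + m t r" if "s \<le> t" "t \<le> r" for s t r
  proof -
    have "U \<inter> {s<..r} = (U \<inter> {s<..t}) \<union> (U \<inter> {t<..r})" using that by auto
    then show ?thesis unfolding m_def
      by (simp add: measure_Un_AE fm)
  qed
  have bound: "norm (f b - f a) \<le> (B + e) * (b - a) + (K + e) * measure lborel U" if e: "e > 0" for e
  proof -
    define P where "P s t \<longleftrightarrow> (a \<le> s \<and> t \<le> b \<longrightarrow> norm (f t - f s) \<le> (B + e) * (t - s) + (K + e) * m s t)" for s t
    \<comment> \<open>\<open>P\<close> is additive in the interval and holds for all short intervals around any given point,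
      so bisection gives it for \<open>[a, b]\<close>.\<close>
    have "P a b" using ab
    proof (induction rule: Bolzano)
      case (trans s t r)
      show ?case unfolding P_def
      proof
        assume "a \<le> s \<and> r \<le> b"
        then have "norm (f t - f s) \<le> (B + e) * (t - s) + (K + e) * m s t"
          "norm (f r - f t) \<le> (B + e) * (r - t) + (K + e) * m t r"
          using trans unfolding P_def by auto
        moreover have "norm (f r - f s) \<le> norm (f t - f s) + norm (f r - f t)"
          by (metis add.commute diff_add_cancel add_diff_eq norm_triangle_ineq)
        ultimately show "norm (f r - f s) \<le> (B + e) * (r - s) + (K + e) * m s r"
          by (simp add: madd[OF trans(3,4)] algebra_simps)
      qed
    next
      case (local x)
      show ?case
      proof (cases "x \<in> U")
        case True
        have "pointwise_lipschitz K f x" using on True local by auto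
        then obtain d where d: "d > 0" "\<And>y. norm (y - x) < d \<Longrightarrow> norm (f y - f x) \<le> (K + e) * norm (y - x)"
          using pointwise_lipschitzD[of K f x "K + e"] e by auto
        obtain d' where d': "d' > 0" "\<And>y. dist y x < d' \<Longrightarrow> y \<in> U"
          using U True by (meson open_dist)
        show ?thesis
        proof (intro exI[of _ "min d d'"] conjI allI impI)
          show "min d d' > 0" using d d' by simp
          fix s t assume st: "s \<le> x \<and> x \<le> t \<and> t - s < min d d'"
          have "U \<inter> {s<..t} = {s<..t}" using st by (auto intro!: d' simp: dist_real_def)
          then have mst: "m s t = t - s" using st by (simp add: m_def)
          have "norm (f t - f s) \<le> norm (f t - f x) + norm (f s - f x)"
            using norm_triangle_ineq4[of "f t - f x" "f s - f x"] by simp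
          moreover have "norm (f t - f x) \<le> (K + e) * (t - x)" "norm (f s - f x) \<le> (K + e) * (x - s)"
            using d(2)[of t] d(2)[of s] st by auto
          moreover have "(B + e) * (t - s) \<ge> 0" using nn e st by auto
          ultimately show "P s t" unfolding P_def mst by (simp add: algebra_simps)
        qed
      next
        case False
        have "pointwise_lipschitz B f x" using off False local by auto
        then obtain d where d: "d > 0" "\<And>y. norm (y - x) < d \<Longrightarrow> norm (f y - f x) \<le> (B + e) * norm (y - x)"
          using pointwise_lipschitzD[of B f x "B + e"] e by auto
        show ?thesis
        proof (intro exI[of _ d] conjI allI impI)
          show "d > 0" using d by simp
          fix s t assume st: "s \<le> x \<and> x \<le> t \<and> t - s < d"
          have "norm (f t - f s) \<le> norm (f t - f x) + norm (f s - f x)"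
            using norm_triangle_ineq4[of "f t - f x" "f s - f x"] by simp
          moreover have "norm (f t - f x) \<le> (B + e) * (t - x)" "norm (f s - f x) \<le> (B + e) * (x - s)"
            using d(2)[of t] d(2)[of s] st by auto
          moreover have "(K + e) * m s t \<ge> 0" using nn e m0 by auto
          ultimately show "P s t" unfolding P_def by (simp add: algebra_simps)
        qed
      qed
    qed
    then have "norm (f b - f a) \<le> (B + e) * (b - a) + (K + e) * m a b" by (simp add: P_def)
    also have "\<dots> \<le> (B + e) * (b - a) + (K + e) * measure lborel U"
      using mle nn e by (simp add: mult_left_mono)
    finally show ?thesis .
  qed
  have "((\<lambda>e. (B + e) * (b - a) + (K + e) * measure lborel U) \<longlongrightarrow>
          (B + 0) * (b - a) + (K + 0) * measure lborel U) (at_right 0)"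
    by (intro tendsto_intros)
  then show ?thesis
    using tendsto_lowerbound[of _ _ "at_right (0::real)" "norm (f b - f a)"] bound
    by (auto simp: eventually_at_right_less eventually_at_filter)
qed

lemma pointwise_lipschitz_imp_lipschitz_on:
  assumes "\<And>x. pointwise_lipschitz B f x" "B \<ge> 0"
  shows "B-lipschitz_on UNIV f"
proof (rule lipschitz_onI)
  fix x y
  have "norm (f (x + 1 *\<^sub>R (y - x)) - f (x + 0 *\<^sub>R (y - x))) \<le>
          (B * norm (y - x)) * (1 - 0) + 0 * measure lborel ({}::real set)"
    using assms by (intro increment_bound_exceptional_open[of 0 1])
      (auto intro: pointwise_lipschitz_along_line)
  then show "dist (f x) (f y) \<le> B * dist x y"
    by (simp add: dist_norm norm_minus_commute)
qed (use assms in auto)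

text \<open>By Fubini, almost every translate of a segment meets the null set of bad points in a
  one-dimensional null set \<open>N1\<close>. On such a translate close to the given segment, cover \<open>N1\<close> by an
  open set of small measure, on which the a priori constant \<open>K\<close> is good enough.\<close>

lemma lipschitz_on_AE_pointwise:
  fixes f :: "'a::euclidean_space \<Rightarrow> 'b::real_normed_vector"
  assumes lip: "K-lipschitz_on UNIV f" and S: "open S" "convex S" and B: "0 \<le> B"
    and AE: "AE x in lborel. x \<in> S \<longrightarrow> pointwise_lipschitz B f x"
  shows "B-lipschitz_on S f"
proof (rule lipschitz_onI)
  have K: "K \<ge> 0" using lip lipschitz_on_nonneg by blast
  obtain N where N: "N \<in> null_sets lborel" "\<And>x. x \<in> S \<Longrightarrow> x \<notin> N \<Longrightarrow> pointwise_lipschitz B f x"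
    using AE by (auto elim!: AE_E2 simp: eventually_ae_filter)
  fix a b assume ab: "a \<in> S" "b \<in> S"
  define v where "v = b - a"
  have Nb[measurable]: "N \<in> sets borel" using N by auto
  have line_AE: "AE c in lborel. AE s in lborel. a + c + s *\<^sub>R v \<notin> N"
  proof (subst lborel_pair.AE_commute)
    show "{x \<in> space (lborel \<Otimes>\<^sub>M lborel). a + fst x + snd x *\<^sub>R v \<notin> N} \<in> sets (lborel \<Otimes>\<^sub>M lborel)"
      by measurable
    have "AE c in lborel. a + c + s *\<^sub>R v \<notin> N" for s
    proof -
      have "AE x in distr lborel borel ((+) (a + s *\<^sub>R v)). x \<notin> N"
        unfolding lborel_distr_plus using N(1) by (rule AE_not_in)
      then show ?thesis by (subst (asm) AE_distr_iff) (auto simp: add_ac)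
    qed
    then show "AE s in lborel. AE c in lborel. a + c + s *\<^sub>R v \<notin> N" by simp
  qed
  have shift: "\<exists>c. norm c < e \<and> (AE s in lborel. a + c + s *\<^sub>R v \<notin> N)" if "e > 0" for e
  proof (rule ccontr)
    assume none: "\<nexists>c. norm c < e \<and> (AE s in lborel. a + c + s *\<^sub>R v \<notin> N)"
    from line_AE have "AE c in lborel. c \<notin> ball (0::'a) e"
      by (rule eventually_mono) (use none in auto)
    then have "ball (0::'a) e \<in> null_sets lborel"
      by (subst (asm) AE_iff_null_sets[symmetric]) auto
    then show False using \<open>e > 0\<close> emeasure_lborel_ball_finite content_ball_pos[of e "0::'a"]
      by (auto simp: null_sets_def measure_def)
  qed
  obtain d1 d2 where d12: "d1 > 0" "ball a d1 \<subseteq> S" "d2 > 0" "ball b d2 \<subseteq> S"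
    using S(1) ab by (meson open_contains_ball)
  define d where "d = min d1 d2"
  have d: "d > 0" "ball a d \<subseteq> S" "ball b d \<subseteq> S"
    using d12 by (auto simp: d_def)
  \<comment> \<open>\<open>e\<close> bounds both the length of the translation and the measure of the exceptional open set.\<close>
  have key: "norm (f b - f a) \<le> B * norm v + 2 * K * e + K * norm v * e" if e: "e > 0" "e < d" for e
  proof -
    obtain c where c: "norm c < e" "AE s in lborel. a + c + s *\<^sub>R v \<notin> N" using shift e by blast
    define N1 where "N1 = {s::real. a + c + s *\<^sub>R v \<in> N}"
    have N1: "N1 \<in> null_sets lborel"
    proof -
      have "N1 \<in> sets lborel" unfolding N1_def by measurable
      then show ?thesis using c(2) by (subst AE_iff_null_sets) (auto simp: N1_def)
    qed
    have "N1 \<in> sets borel" using N1 by auto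
    from outer_regular_lborel[OF this e(1)]
    obtain U where U: "open U" "N1 \<subseteq> U" "emeasure lborel (U - N1) < e" .
    have "emeasure lborel U = emeasure lborel (U - N1)"
      using N1 U by (subst emeasure_Diff_null_set) auto
    then have Um: "emeasure lborel U < e" using U by simp
    then have Umm: "measure lborel U \<le> e"
      using e by (simp add: measure_def enn2real_leI less_imp_le)
    have inS: "a + c + s *\<^sub>R v \<in> S" if "s \<in> {0..1}" for s
    proof -
      have "a + c \<in> S" "b + c \<in> S" using d c e by (auto simp: dist_norm subset_iff)
      moreover have "a + c + s *\<^sub>R v = (1 - s) *\<^sub>R (a + c) + s *\<^sub>R (b + c)"
        by (simp add: v_def algebra_simps)
      ultimately show ?thesis using S(2) that by (simp add: convexD)
    qed
    have "norm (f (a + c + 1 *\<^sub>R v) - f (a + c + 0 *\<^sub>R v)) \<le>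
            B * norm v * (1 - 0) + K * norm v * measure lborel U"
    proof (rule increment_bound_exceptional_open)
      show "emeasure lborel U < \<infinity>" using less_trans[OF Um ennreal_less_top] by simp
      show "pointwise_lipschitz (B * norm v) (\<lambda>s. f (a + c + s *\<^sub>R v)) s" if "s \<in> {0..1}" "s \<notin> U" for s
        using that U inS by (intro pointwise_lipschitz_along_line N) (auto simp: N1_def)
      show "pointwise_lipschitz (K * norm v) (\<lambda>s. f (a + c + s *\<^sub>R v)) s" for s
        by (intro pointwise_lipschitz_along_line lipschitz_on_imp_pointwise_lipschitz lip)
    qed (use U B K in auto)
    also have "\<dots> \<le> B * norm v + K * norm v * e" using Umm K by (simp add: mult_left_mono)
    finally have 1: "norm (f (b + c) - f (a + c)) \<le> B * norm v + K * norm v * e"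
      by (simp add: v_def algebra_simps)
    have 2: "norm (f (x + c) - f x) \<le> K * e" for x
    proof -
      have "norm (f (x + c) - f x) \<le> K * norm c" using lipschitz_onD[OF lip, of "x + c" x] by (simp add: dist_norm)
      also have "\<dots> \<le> K * e" using c K by (simp add: mult_left_mono)
      finally show ?thesis .
    qed
    have "norm (f b - f a) \<le> norm (f (b + c) - f (a + c)) + norm (f (b + c) - f b) + norm (f (a + c) - f a)"
      using norm_triangle_ineq4[of "f (b + c) - f (a + c)" "f (b + c) - f b"]
        norm_triangle_ineq[of "f (b + c) - f (a + c) - (f (b + c) - f b)" "f (a + c) - f a"] by simp
    then show ?thesis using 1 2[of a] 2[of b] by linarith
  qed
  have "((\<lambda>e. B * norm v + 2 * K * e + K * norm v * e) \<longlongrightarrow> B * norm v + 2 * K * 0 + K * norm v * 0) (at_right 0)"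
    by (intro tendsto_intros)
  moreover have "eventually (\<lambda>e. norm (f b - f a) \<le> B * norm v + 2 * K * e + K * norm v * e) (at_right 0)"
    unfolding eventually_at_right_field using d key by auto
  ultimately have "norm (f b - f a) \<le> B * norm v"
    using tendsto_lowerbound[of _ _ "at_right (0::real)" "norm (f b - f a)"] by fastforce
  then show "dist (f a) (f b) \<le> B * dist a b" by (simp add: dist_norm v_def norm_minus_commute)
qed (use B in auto)

section \<open>The chordal metric\<close>

text \<open>Stereographic projection onto the sphere of diameter \<open>1\<close> centred at \<open>(0, 1/2)\<close>. The chordal
  metric is the Euclidean distance of the images, which yields the triangle inequality.\<close>

fun stereographic :: "'a::euclidean_space option \<Rightarrow> 'a \<times> real" where
  "stereographic (Some x) = (x /\<^sub>R (1 + (norm x)\<^sup>2), (norm x)\<^sup>2 / (1 + (norm x)\<^sup>2))"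
| "stereographic None = (0, 1)"

lemma chordal_eq_dist_stereographic: "chordal p q = dist (stereographic p) (stereographic q)"
proof -
  have one: "1 + (norm x)\<^sup>2 > 0" for x :: 'a by (simp add: add_pos_nonneg)
  have at_None: "(dist (stereographic (Some x)) (stereographic None))\<^sup>2 = (chordal (Some x) None)\<^sup>2"
    for x :: 'a
  proof -
    define X where "X = (norm x)\<^sup>2"
    have X: "1 + X > 0" using one[of x] by (simp add: X_def)
    then have "(norm (x /\<^sub>R (1 + X)))\<^sup>2 = X / (1 + X)\<^sup>2"
      by (simp add: power_mult_distrib power_inverse divide_inverse mult.commute flip: X_def)
    moreover have "X / (1 + X)\<^sup>2 + (1 - X / (1 + X))\<^sup>2 = 1 / (1 + X)"
      using X by (simp add: divide_simps) (simp add: power2_eq_square algebra_simps)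
    ultimately show ?thesis
      using X by (simp add: dist_prod_def dist_norm power_divide add_nonneg_nonneg flip: X_def)
  qed
  have sq: "(dist (stereographic p) (stereographic q))\<^sup>2 = (chordal p q)\<^sup>2"
  proof (cases p; cases q)
    fix x y assume [simp]: "p = Some x" "q = Some y"
    define X Y where "X = (norm x)\<^sup>2" "Y = (norm y)\<^sup>2"
    have pos: "1 + X > 0" "1 + Y > 0" using one[of x] one[of y] by (auto simp: X_Y_def)
    have XY: "x \<bullet> x = X" "y \<bullet> y = Y" by (auto simp: X_Y_def power2_norm_eq_inner)
    have "(chordal p q)\<^sup>2 = (X + Y - 2 * (x \<bullet> y)) / ((1 + X) * (1 + Y))"
      using pos by (simp add: power_divide power_mult_distrib X_Y_def[symmetric] power2_norm_eq_inner[of "x - y"]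
          inner_diff_left inner_diff_right XY inner_commute)
    moreover have "(dist (stereographic p) (stereographic q))\<^sup>2 =
        X / (1+X)^2 + Y / (1+Y)^2 - 2 * (x \<bullet> y) / ((1+X) * (1+Y)) + (X / (1 + X) - Y / (1 + Y))^2"
    proof -
      have "(norm (a *\<^sub>R x - b *\<^sub>R y))\<^sup>2 = a\<^sup>2 * X + b\<^sup>2 * Y - 2 * (x \<bullet> y) * (a * b)" for a b
        by (simp add: power2_norm_eq_inner inner_diff_left inner_diff_right XY inner_commute[of y x])
           (simp add: power2_eq_square algebra_simps)
      from this[of "inverse (1 + X)" "inverse (1 + Y)"] show ?thesis
        unfolding dist_prod_def
        by (subst real_sqrt_pow2, intro add_nonneg_nonneg zero_le_power2)
          (simp_all add: X_Y_def[symmetric] dist_norm divide_inverse power_inverse mult_ac)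
    qed
    moreover have "X / (1+X)^2 + Y / (1+Y)^2 - 2 * (x \<bullet> y) / ((1+X) * (1+Y)) + (X / (1 + X) - Y / (1 + Y))^2
        = (X + Y - 2 * (x \<bullet> y)) / ((1 + X) * (1 + Y))"
    proof -
      have "1 + X \<noteq> 0" "1 + Y \<noteq> 0" using pos by auto
      then show ?thesis by (simp add: divide_simps) (simp add: power2_eq_square power4_eq_xxxx algebra_simps)
    qed
    ultimately show ?thesis by simp
  next
    fix x assume [simp]: "p = None" "q = Some x"
    show ?thesis using at_None[of x] by (simp add: dist_commute)
  next
    fix x assume [simp]: "q = None" "p = Some x"
    show ?thesis using at_None[of x] by simp
  qed simp
  have "chordal p q \<ge> 0" by (cases p; cases q) auto
  then show ?thesis using sq by (simp add: power2_eq_iff_nonneg)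
qed

lemma chordal_eq_0_iff: "chordal p q = 0 \<longleftrightarrow> p = q"
proof -
  have "1 + (norm x)\<^sup>2 > 0" for x :: 'a by (simp add: add_pos_nonneg)
  then have "sqrt (1 + (norm x)\<^sup>2) > 0" for x :: 'a by simp
  then show ?thesis by (cases p; cases q) (auto simp: less_imp_neq[symmetric])
qed

lemma Metric_space_chordal: "Metric_space UNIV (chordal :: 'a::euclidean_space option \<Rightarrow> _)"
proof
  fix p q r :: "'a option"
  show "chordal p q \<ge> 0" "chordal p q = chordal q p" "chordal p r \<le> chordal p q + chordal q r"
    by (simp_all add: chordal_eq_dist_stereographic dist_commute dist_triangle)
qed (rule chordal_eq_0_iff)

text \<open>For an involution the upper bound implies the lower one and the continuity of the inverse.\<close>

lemma bilipschitz_chordal_involution: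
  fixes f :: "'a::euclidean_space option \<Rightarrow> 'a option"
  assumes inv: "\<And>p. f (f p) = p" and C: "C > 0" and le: "\<And>p q. chordal (f p) (f q) \<le> C * chordal p q"
  shows "bilipschitz chordal C f"
proof -
  interpret Metric_space UNIV "chordal :: 'a option \<Rightarrow> _" by (rule Metric_space_chordal)
  have "continuous_map mtopology mtopology f"
    unfolding metric_continuous_map[OF Metric_space_chordal]
  proof (intro conjI ballI allI impI)
    fix a and e :: real assume e: "e > 0"
    show "\<exists>d>0. \<forall>x. x \<in> UNIV \<and> chordal a x < d \<longrightarrow> chordal (f a) (f x) < e"
      using e C le[of a] by (intro exI[of _ "e / C"])
        (auto simp: pos_less_divide_eq mult.commute intro: le_less_trans)
  qed simp
  then have "homeomorphic_map mtopology mtopology f"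
    by (intro homeomorphic_maps_imp_map[of _ _ f f]) (auto simp: homeomorphic_maps_def inv)
  moreover have "chordal p q / C \<le> chordal (f p) (f q)" for p q
    using le[of "f p" "f q"] C by (simp add: inv pos_divide_le_eq mult.commute)
  ultimately show ?thesis using C le by (simp add: bilipschitz_def)
qed

lemma bilipschitz_chordal_ge_1:
  fixes f :: "'a::euclidean_space option \<Rightarrow> 'a option"
  assumes "bilipschitz chordal C f"
  shows "1 \<le> C"
proof (rule ccontr)
  assume "\<not> 1 \<le> C"
  have d: "chordal (None :: 'a option) (Some 0) = 1" by simp
  have "C > 0" "1 / C \<le> C" using assms d unfolding bilipschitz_def
    by auto (metis d mult.right_neutral order_trans)
  then have "1 \<le> C * C" by (simp add: pos_divide_le_eq)
  moreover have "C * C < 1" using \<open>C > 0\<close> \<open>\<not> 1 \<le> C\<close> by (smt (verit) mult_less_cancel_left2)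
  ultimately show False by simp
qed

text \<open>The least bi-Lipschitz constant is attained: the constants are bounded below by \<open>1\<close>, and their
  infimum is again one of them.\<close>

lemma bilipschitz_const_chordal:
  fixes f :: "'a::euclidean_space option \<Rightarrow> 'a option"
  assumes C: "bilipschitz chordal C f"
  shows "bilipschitz chordal (bilipschitz_const chordal f) f" "bilipschitz_const chordal f \<le> C"
proof -
  define S where "S = {C. bilipschitz chordal C f}"
  define m where "m = Inf S"
  have S: "C \<in> S" "\<And>B. B \<in> S \<Longrightarrow> 1 \<le> B" using C bilipschitz_chordal_ge_1 by (auto simp: S_def)
  have bdd: "bdd_below S" using S(2) by (auto simp: bdd_below_def)
  have m1: "m \<ge> 1" unfolding m_def using S by (intro cInf_greatest) auto
  have mle: "m \<le> B" if "B \<in> S" for B using that bdd unfolding m_def by (rule cInf_lower)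
  have inf: "x \<le> m * y" if y: "y \<ge> 0" and "\<And>B. B \<in> S \<Longrightarrow> x \<le> B * y" for x y :: real
  proof (cases "y = 0")
    case True
    then show ?thesis using that(2)[OF S(1)] by simp
  next
    case False
    then have "x / y \<le> m" unfolding m_def
      using S(1) that by (intro cInf_greatest) (auto simp: pos_divide_le_eq)
    then show ?thesis using False y by (simp add: pos_divide_le_eq)
  qed
  have nn: "chordal p q \<ge> 0" for p q :: "'a option" by (simp add: chordal_eq_dist_stereographic)
  have "bilipschitz chordal m f"
    unfolding bilipschitz_def
  proof (intro conjI allI)
    fix p q
    show "chordal (f p) (f q) \<le> m * chordal p q"
      using nn by (rule inf) (auto simp: S_def bilipschitz_def)
    have "chordal p q \<le> m * chordal (f p) (f q)"
      using nn by (rule inf) (auto simp: S_def bilipschitz_def pos_divide_le_eq mult.commute)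
    then show "chordal p q / m \<le> chordal (f p) (f q)"
      using m1 by (simp add: pos_divide_le_eq mult.commute)
  qed (use C m1 in \<open>auto simp: bilipschitz_def\<close>)
  moreover from this have "bilipschitz_const chordal f = m"
    unfolding bilipschitz_const_def using mle by (intro Least_equality) (auto simp: S_def)
  ultimately show "bilipschitz chordal (bilipschitz_const chordal f) f" "bilipschitz_const chordal f \<le> C"
    using mle S by auto
qed

text \<open>The inversion in the unit sphere, extended to the point at infinity. Under the stereographic
  projection it becomes a reflection, so that it is a chordal isometry.\<close>

fun inversion :: "'a::euclidean_space option \<Rightarrow> 'a option" where
  "inversion None = Some 0"
| "inversion (Some x) = (if x = 0 then None else Some (x /\<^sub>R (norm x)\<^sup>2))"

lemma stereographic_inversion:
  "stereographic (inversion p) = (fst (stereographic p), 1 - snd (stereographic p))"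
proof (cases p)
  case (Some x)
  have "1 + (norm x)\<^sup>2 > 0" by (simp add: add_pos_nonneg)
  moreover have "1 + 1 / (norm x)\<^sup>2 = (1 + (norm x)\<^sup>2) / (norm x)\<^sup>2" if "x \<noteq> 0"
    using that by (simp add: field_simps)
  ultimately show ?thesis using Some
    by (auto simp: field_simps power2_eq_square)
qed simp

lemma chordal_inversion: "chordal (inversion p) (inversion q) = chordal p q"
  unfolding chordal_eq_dist_stereographic stereographic_inversion
  by (simp add: dist_prod_def dist_norm power2_commute)

lemma sqrt_one_plus_square_mono:
  assumes "0 \<le> a" "a \<le> C * b" "1 \<le> (C::real)"
  shows "sqrt (1 + a\<^sup>2) \<le> C * sqrt (1 + b\<^sup>2)"
proof -
  have "a\<^sup>2 \<le> (C * b)\<^sup>2" using assms by (intro power_mono) auto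
  moreover have "1 \<le> C\<^sup>2" using assms by simp
  ultimately have "1 + a\<^sup>2 \<le> C\<^sup>2 * (1 + b\<^sup>2)" by (simp add: algebra_simps power_mult_distrib)
  then have "sqrt (1 + a\<^sup>2) \<le> sqrt (C\<^sup>2 * (1 + b\<^sup>2))" by simp
  then show ?thesis using assms by (simp add: real_sqrt_mult)
qed

text \<open>One factor \<open>C\<close> comes from the numerator of the chordal metric and one from each of the two square
  roots in its denominator.\<close>

lemma chordal_map_option_le:
  fixes g :: "'a::euclidean_space \<Rightarrow> 'a"
  assumes C: "1 \<le> C" and up: "\<And>x y. norm (g x - g y) \<le> C * norm (x - y)"
    and lo: "\<And>x. norm x \<le> C * norm (g x)"
  shows "chordal (map_option g p) (map_option g q) \<le> C ^ 3 * chordal p q"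
proof -
  define w where "w x = sqrt (1 + (norm x)\<^sup>2)" for x :: 'a
  have w: "w x > 0" for x unfolding w_def by (simp add: add_pos_nonneg)
  have wg: "w x \<le> C * w (g x)" for x
    unfolding w_def using lo C by (intro sqrt_one_plus_square_mono) auto
  have inv: "1 / w (g x) \<le> C / w x" for x using wg[of x] w[of x] w[of "g x"] by (simp add: field_simps)
  have C3: "C \<le> C ^ 3" using C by (simp add: self_le_power)
  have None: "1 / w (g x) \<le> C ^ 3 * (1 / w x)" for x
    using inv[of x] C3 w[of x] by (simp add: divide_right_mono order_trans)
  show ?thesis
  proof (cases p; cases q)
    fix x y assume [simp]: "p = Some x" "q = Some y"
    have "norm (g x - g y) * ((1 / w (g x)) * (1 / w (g y))) \<le> (C * norm (x - y)) * ((C / w x) * (C / w y))"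
      using up inv C w by (intro mult_mono) (auto simp: less_imp_le)
    then show ?thesis by (simp add: w_def[symmetric] power3_eq_cube mult_ac)
  next
    fix x assume [simp]: "p = None" "q = Some x"
    show ?thesis using None by (simp add: w_def[symmetric])
  next
    fix x assume [simp]: "q = None" "p = Some x"
    show ?thesis using None by (simp add: w_def[symmetric])
  qed simp
qed

section \<open>Maps that rescale each ray\<close>

text \<open>The component of \<open>y\<close> orthogonal to \<open>x\<close>, which for \<open>x = 0\<close> is \<open>y\<close> itself because \<open>sgn 0 = 0\<close>.\<close>

definition perp :: "'a::real_inner \<Rightarrow> 'a \<Rightarrow> 'a" where
  "perp x y = y - (y \<bullet> sgn x) *\<^sub>R sgn x"

lemma inner_sgn_self: "x \<bullet> sgn x = norm x"
  for x :: "'a::real_inner"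
  by (cases "x = 0") (simp_all add: sgn_div_norm dot_square_norm power2_eq_square)

lemma perp_self: "perp x x = 0"
  by (cases "x = 0") (simp_all add: perp_def inner_sgn_self, simp add: sgn_div_norm)

lemma perp_diff: "perp x (y - z) = perp x y - perp x z"
  by (simp add: perp_def inner_diff_left algebra_simps)

lemma perp_scaleR: "perp x (c *\<^sub>R y) = c *\<^sub>R perp x y"
  by (simp add: perp_def algebra_simps)

lemma isCont_perp: "isCont (perp x) y"
  unfolding perp_def by (intro continuous_intros)

lemma norm_add_sgn_sq:
  assumes "x \<noteq> 0"
  shows "(norm (y + s *\<^sub>R sgn x))\<^sup>2 = (y \<bullet> sgn x + s)\<^sup>2 + (norm (perp x y))\<^sup>2"
proof -
  have "sgn x \<bullet> sgn x = 1" using assms by (simp add: norm_sgn flip: power2_norm_eq_inner)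
  then show ?thesis
    by (simp add: perp_def power2_norm_eq_inner inner_diff_left inner_diff_right inner_add_left
        inner_add_right inner_commute[of "sgn x" y])
       (simp add: power2_eq_square algebra_simps)
qed

lemmas norm_sq_perp = norm_add_sgn_sq[where s = 0, simplified]

text \<open>The operator norm of a planar shear of strength \<open>k\<close>, the larger root of \<open>c\<^sup>2 = 1 + k c\<close>.\<close>

definition shear_norm :: "real \<Rightarrow> real" where
  "shear_norm k = (k + sqrt (k\<^sup>2 + 4)) / 2"

lemma shear_norm:
  assumes "k \<ge> 0"
  shows "shear_norm k \<ge> 1" "(shear_norm k)\<^sup>2 = 1 + k * shear_norm k"
proof -
  have "2 \<le> sqrt (k\<^sup>2 + 4)" by (rule real_le_rsqrt) simp
  then show "shear_norm k \<ge> 1" using assms by (simp add: shear_norm_def)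
  have "(sqrt (k\<^sup>2 + 4))\<^sup>2 = k\<^sup>2 + 4" by simp
  then show "(shear_norm k)\<^sup>2 = 1 + k * shear_norm k"
    unfolding shear_norm_def by (simp add: power2_eq_square field_simps)
qed

lemma norm_shear_le:
  fixes x y :: "'a::real_inner"
  assumes x: "x \<noteq> 0" and k: "k \<ge> 0" and s: "\<bar>s\<bar> \<le> k * norm (perp x y)"
  shows "norm (y + s *\<^sub>R sgn x) \<le> shear_norm k * norm y"
proof -
  define p where "p = \<bar>y \<bullet> sgn x\<bar>"
  define q where "q = norm (perp x y)"
  define c where "c = shear_norm k"
  have c: "c \<ge> 1" "c\<^sup>2 = 1 + k * c" using shear_norm[OF k] by (auto simp: c_def)
  have "(norm (y + s *\<^sub>R sgn x))\<^sup>2 = (y \<bullet> sgn x + s)\<^sup>2 + q\<^sup>2"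
    using norm_add_sgn_sq[OF x] by (simp add: q_def)
  also have "(y \<bullet> sgn x + s)\<^sup>2 \<le> (p + k * q)\<^sup>2"
    using s by (subst abs_le_square_iff[symmetric]) (auto simp: p_def q_def)
  also have "(p + k * q)\<^sup>2 + q\<^sup>2 \<le> c\<^sup>2 * (p\<^sup>2 + q\<^sup>2)"
  proof -
    \<comment> \<open>By \<open>c\<^sup>2 = 1 + k c\<close>, the difference of the two sides is \<open>k / c\<close> times the square \<open>(c p - q)\<^sup>2\<close>.\<close>
    have one: "c\<^sup>2 - k * c = 1" using c(2) by simp
    have "0 \<le> (c * p - q)\<^sup>2" by simp
    also have "(c * p - q)\<^sup>2 = c\<^sup>2 * p\<^sup>2 - 2 * c * p * q + (c\<^sup>2 - k * c) * q\<^sup>2"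
      unfolding one by (simp add: power2_eq_square algebra_simps)
    also have "\<dots> = c * (c * p\<^sup>2 - 2 * p * q + (c - k) * q\<^sup>2)"
      by (simp add: power2_eq_square algebra_simps)
    finally have "0 \<le> c * p\<^sup>2 - 2 * p * q + (c - k) * q\<^sup>2"
      using c(1) by (simp add: zero_le_mult_iff)
    then have "0 \<le> k * (c * p\<^sup>2 - 2 * p * q + (c - k) * q\<^sup>2)" using k by simp
    also have "\<dots> = c\<^sup>2 * (p\<^sup>2 + q\<^sup>2) - ((p + k * q)\<^sup>2 + q\<^sup>2)"
      unfolding c(2) by (simp add: power2_eq_square algebra_simps)
    finally show ?thesis by simp
  qed
  also have "p\<^sup>2 + q\<^sup>2 = (norm y)\<^sup>2" using norm_sq_perp[OF x, of y] by (simp add: p_def q_def)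
  finally have "(norm (y + s *\<^sub>R sgn x))\<^sup>2 \<le> (c * norm y)\<^sup>2" by (simp add: power_mult_distrib)
  then show ?thesis using c(1) by (simp add: c_def power2_le_iff_abs_le)
qed

text \<open>Infinitesimally, the relative change of \<open>g\<close> at \<open>x\<close> is at most \<open>k\<close> times the component of the
  displacement orthogonal to \<open>x\<close>, measured in units of \<open>norm x\<close>. For a positive differentiable
  function that is constant on rays this bounds the tangential gradient of \<open>ln g\<close> on the unit sphere by \<open>k\<close>.\<close>

definition radially_lipschitz :: "real \<Rightarrow> ('a::real_inner \<Rightarrow> real) \<Rightarrow> bool" where
  "radially_lipschitz k g \<longleftrightarrow> (\<forall>x. x \<noteq> 0 \<longrightarrow> isCont g x \<and>
     (\<forall>C>k. eventually (\<lambda>y. \<bar>g y - g x\<bar> \<le> C * (g x / norm x) * norm (perp x y)) (at x)))"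

lemma radially_lipschitz_inverse:
  assumes g: "radially_lipschitz k g" and k: "k \<ge> 0" and pos: "\<And>x. x \<noteq> 0 \<Longrightarrow> g x > 0"
  shows "radially_lipschitz k (\<lambda>x. 1 / g x)"
  unfolding radially_lipschitz_def
proof (intro allI impI conjI)
  fix x :: 'a assume x: "x \<noteq> 0"
  have gx: "g x > 0" using pos x by simp
  have cont: "isCont g x" using g x by (auto simp: radially_lipschitz_def)
  then show "isCont (\<lambda>x. 1 / g x) x" using gx by (intro continuous_intros) auto
  fix C assume "C > k"
  then obtain C' where C': "k < C'" "C' < C" using dense by blast
  have "eventually (\<lambda>y. \<bar>g y - g x\<bar> \<le> C' * (g x / norm x) * norm (perp x y)) (at x)"
    using g x C' by (auto simp: radially_lipschitz_def)
  moreover have "eventually (\<lambda>y. C' * g x / g y < C) (at x)"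
  proof (rule order_tendstoD)
    show "((\<lambda>y. C' * g x / g y) \<longlongrightarrow> C' * g x / g x) (at x)"
      using cont gx by (intro tendsto_intros) (auto simp: isCont_def)
  qed (use C' gx in auto)
  moreover have "eventually (\<lambda>y. g y > 0) (at x)"
    using order_tendstoD(1)[OF _ gx] cont by (auto simp: isCont_def)
  ultimately show "eventually (\<lambda>y. \<bar>1 / g y - 1 / g x\<bar> \<le> C * (1 / g x / norm x) * norm (perp x y)) (at x)"
  proof eventually_elim
    case (elim y)
    have "\<bar>1 / g y - 1 / g x\<bar> = \<bar>g y - g x\<bar> / (g x * g y)"
      using elim gx by (simp add: divide_simps abs_minus_commute abs_mult)
    also have "\<dots> \<le> C' * (g x / norm x) * norm (perp x y) / (g x * g y)"
      using elim gx by (intro divide_right_mono) auto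
    also have "\<dots> = (C' * g x / g y) * (1 / g x / norm x * norm (perp x y))"
      using elim gx by (simp add: field_simps)
    also have "\<dots> \<le> C * (1 / g x / norm x * norm (perp x y))"
      using elim gx by (intro mult_right_mono) auto
    finally show ?case by (simp add: mult.assoc)
  qed
qed

text \<open>Up to terms of higher order, the increment of \<open>g x *\<^sub>R x\<close> is \<open>g x\<close> times a shear of strength
  at most \<open>k\<close> applied to the displacement. At the origin the bound \<open>R\<close> on \<open>g\<close> suffices.\<close>

lemma radial_map_lipschitz:
  fixes g :: "'a::real_inner \<Rightarrow> real"
  assumes g: "radially_lipschitz k g" and k: "k \<ge> 0"
    and pos: "\<And>x. x \<noteq> 0 \<Longrightarrow> g x > 0" and le: "\<And>x. x \<noteq> 0 \<Longrightarrow> g x \<le> R" and R: "R \<ge> 0"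
  shows "(R * shear_norm k)-lipschitz_on UNIV (\<lambda>x. g x *\<^sub>R x)"
proof (rule pointwise_lipschitz_imp_lipschitz_on)
  have k1: "shear_norm k \<ge> 1" using shear_norm k by auto
  then show "R * shear_norm k \<ge> 0" using R by simp
  fix x :: 'a
  show "pointwise_lipschitz (R * shear_norm k) (\<lambda>x. g x *\<^sub>R x) x"
    unfolding pointwise_lipschitz_def
  proof (intro allI impI)
    fix C assume C: "R * shear_norm k < C"
    show "eventually (\<lambda>y. norm (g y *\<^sub>R y - g x *\<^sub>R x) \<le> C * norm (y - x)) (at x)"
    proof (cases "x = 0")
      case True
      have "R * 1 \<le> R * shear_norm k" using k1 R by (intro mult_left_mono)
      then have "g y * norm y \<le> C * norm y" if "y \<noteq> 0" for y :: 'a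
        using le[OF that] C by (intro mult_right_mono) auto
      moreover have "eventually (\<lambda>y::'a. y \<noteq> 0) (at 0)" by (simp add: eventually_at_filter)
      ultimately show ?thesis using pos True by (auto elim!: eventually_mono simp: less_imp_le)
    next
      case False
      have cont: "isCont g x" using g False by (auto simp: radially_lipschitz_def)
      have gx: "0 < g x" "g x \<le> R" using pos le False by auto
      have "((\<lambda>k. R * shear_norm k) \<longlongrightarrow> R * shear_norm k) (at_right k)"
        unfolding shear_norm_def by (intro tendsto_intros) auto
      then have "eventually (\<lambda>k. R * shear_norm k < C) (at_right k)"
        using C by (rule order_tendstoD)
      then have "eventually (\<lambda>k'. R * shear_norm k' < C \<and> k < k') (at_right k)"
        by (intro eventually_conj) (auto simp: eventually_at_right_less)
      then obtain k' where k': "R * shear_norm k' < C" "k < k'"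
        using eventually_happens'[OF trivial_limit_at_right_real] by blast
      define e where "e = C - R * shear_norm k'"
      have e: "e > 0" using k' by (simp add: e_def)
      have "eventually (\<lambda>y. \<bar>g y - g x\<bar> \<le> k' * (g x / norm x) * norm (perp x y)) (at x)"
        using g False k' by (auto simp: radially_lipschitz_def)
      moreover have "eventually (\<lambda>y. \<bar>g y - g x\<bar> < e) (at x)"
        using cont e by (auto simp: isCont_def tendsto_iff dist_real_def)
      ultimately show ?thesis
      proof eventually_elim
        case (elim y)
        \<comment> \<open>\<open>s\<close> is the amount by which the shear moves \<open>y - x\<close> along \<open>x\<close>: \<open>(g y - g x) x = g x (s sgn x)\<close>.\<close>
        define s where "s = (g y - g x) * norm x / g x"
        have "\<bar>s\<bar> = \<bar>g y - g x\<bar> * (norm x / g x)" using gx by (simp add: s_def abs_mult)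
        also have "\<dots> \<le> k' * (g x / norm x) * norm (perp x y) * (norm x / g x)"
          using elim gx by (intro mult_right_mono) auto
        also have "\<dots> = k' * norm (perp x (y - x))"
          using gx False by (simp add: perp_diff perp_self)
        finally have "norm (y - x + s *\<^sub>R sgn x) \<le> shear_norm k' * norm (y - x)"
          using False k k' by (intro norm_shear_le) auto
        then have "g x * norm (y - x + s *\<^sub>R sgn x) \<le> R * (shear_norm k' * norm (y - x))"
          using gx by (intro mult_mono) auto
        moreover have "\<bar>g y - g x\<bar> * norm (y - x) \<le> e * norm (y - x)"
          using elim by (intro mult_right_mono) auto
        moreover have "g x * s / norm x = g y - g x" using gx False by (simp add: s_def)
        then have "(g x * s) *\<^sub>R sgn x = (g y - g x) *\<^sub>R x"
          by (simp add: sgn_div_norm divide_inverse)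
        then have "g y *\<^sub>R y - g x *\<^sub>R x =
            g x *\<^sub>R (y - x + s *\<^sub>R sgn x) + (g y - g x) *\<^sub>R (y - x)"
          by (simp add: algebra_simps)
        then have "norm (g y *\<^sub>R y - g x *\<^sub>R x) \<le>
            g x * norm (y - x + s *\<^sub>R sgn x) + \<bar>g y - g x\<bar> * norm (y - x)"
          using norm_triangle_ineq[of "g x *\<^sub>R (y - x + s *\<^sub>R sgn x)" "(g y - g x) *\<^sub>R (y - x)"] gx by simp
        ultimately show ?case by (simp add: e_def algebra_simps)
      qed
    qed
  qed
qed

section \<open>Surfaces that meet each ray once\<close>

text \<open>The only properties of the boundary of a strictly starlike domain that are used below.\<close>

locale star_surface =
  fixes M :: "'a::euclidean_space set"
  assumes compact: "compact M" and zero_notin: "0 \<notin> M"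
    and ray: "\<And>u. u \<noteq> 0 \<Longrightarrow> \<exists>!w. w \<in> M \<and> (\<exists>t>0. w = t *\<^sub>R u)"
begin

text \<open>The distance from the origin to the surface in the direction of \<open>x\<close>.\<close>

definition radius :: "'a \<Rightarrow> real" where
  "radius x = norm (radial_point M x)"

lemma radial_point_in: "x \<noteq> 0 \<Longrightarrow> radial_point M x \<in> M"
  and radial_point_on_ray: "x \<noteq> 0 \<Longrightarrow> \<exists>t>0. radial_point M x = t *\<^sub>R x"
  using theI'[OF ray, of x] unfolding radial_point_def by simp_all

lemma radial_point_eqI:
  assumes "w \<in> M" "w = t *\<^sub>R x" "t > 0"
  shows "radial_point M x = w"
proof -
  have "x \<noteq> 0" using assms zero_notin by auto
  then show ?thesis unfolding radial_point_def using assms by (intro the1_equality ray) auto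
qed

lemma radius_pos: "x \<noteq> 0 \<Longrightarrow> radius x > 0"
  unfolding radius_def zero_less_norm_iff using radial_point_in[of x] zero_notin by metis

lemma radial_point_eq:
  assumes "x \<noteq> 0"
  shows "radial_point M x = (radius x / norm x) *\<^sub>R x"
proof -
  obtain t where "t > 0" "radial_point M x = t *\<^sub>R x" using radial_point_on_ray assms by blast
  then show ?thesis using assms by (simp add: radius_def)
qed

lemma radial_point_scaleR:
  assumes "c > 0"
  shows "radial_point M (c *\<^sub>R x) = radial_point M x"
proof (cases "x = 0")
  case False
  obtain t where t: "t > 0" "radial_point M x = t *\<^sub>R x" using radial_point_on_ray False by blast
  show ?thesis
  proof (rule radial_point_eqI)
    show "radial_point M x \<in> M" using radial_point_in False .
    show "radial_point M x = (t / c) *\<^sub>R (c *\<^sub>R x)" using t assms by simp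
    show "t / c > 0" using t assms by simp
  qed
qed simp

lemma radius_scaleR: "c > 0 \<Longrightarrow> radius (c *\<^sub>R x) = radius x"
  by (simp add: radius_def radial_point_scaleR)

lemma radial_extension_eq: "radial_extension M x = radius x *\<^sub>R x"
proof (cases "x = 0")
  case False
  then have "radial_extension M x = norm x *\<^sub>R radial_point M x"
    by (simp add: radial_extension_def radial_point_scaleR)
  then show ?thesis using False by (simp add: radial_point_eq)
qed (simp add: radial_extension_def)

lemma radial_extension_scaleR: "c > 0 \<Longrightarrow> radial_extension M (c *\<^sub>R x) = c *\<^sub>R radial_extension M x"
  by (simp add: radial_extension_eq radius_scaleR)

text \<open>Central projection is a continuous bijection from the compact surface onto the unit sphere, so its
  inverse is continuous.\<close>

lemma isCont_radial_point:
  assumes "x \<noteq> 0"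
  shows "isCont (radial_point M) x"
proof -
  have "(\<lambda>w. w /\<^sub>R norm w) ` M = sphere 0 1"
  proof (intro equalityI subsetI)
    fix u :: 'a assume u: "u \<in> sphere 0 1"
    then have "u \<noteq> 0" by auto
    then have "u = radial_point M u /\<^sub>R norm (radial_point M u)"
      using u radius_pos[of u] by (simp add: radial_point_eq)
    then show "u \<in> (\<lambda>w. w /\<^sub>R norm w) ` M" using radial_point_in \<open>u \<noteq> 0\<close> by blast
  next
    fix u assume "u \<in> (\<lambda>w. w /\<^sub>R norm w) ` M"
    then obtain w where w: "w \<in> M" "u = w /\<^sub>R norm w" by (rule imageE)
    then have "w \<noteq> 0" using zero_notin by metis
    with w(2) show "u \<in> sphere 0 1" by simp
  qed
  moreover have "continuous_on ((\<lambda>w. w /\<^sub>R norm w) ` M) (radial_point M)"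
  proof (rule continuous_on_inv[OF _ compact])
    show "continuous_on M (\<lambda>w. w /\<^sub>R norm w)" using zero_notin by (intro continuous_intros) auto
    show "\<forall>w\<in>M. radial_point M (w /\<^sub>R norm w) = w"
    proof
      fix w assume w: "w \<in> M"
      then have "w \<noteq> 0" using zero_notin by metis
      with w show "radial_point M (w /\<^sub>R norm w) = w"
        by (intro radial_point_eqI[where t = "norm w"]) simp_all
    qed
  qed
  ultimately have "continuous_on (sphere 0 1) (radial_point M)" by simp
  then have "continuous_on (- {0}) (\<lambda>x. radial_point M (x /\<^sub>R norm x))"
  proof (rule continuous_on_compose2)
    show "continuous_on (- {0}) (\<lambda>x::'a. x /\<^sub>R norm x)" by (intro continuous_intros) auto
    show "(\<lambda>x::'a. x /\<^sub>R norm x) ` (- {0}) \<subseteq> sphere 0 1" by (rule image_subsetI) simp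
  qed
  then have "continuous_on (- {0}) (radial_point M)"
    by (rule continuous_on_eq) (auto intro: radial_point_scaleR)
  then show ?thesis using assms by (simp add: continuous_on_eq_continuous_at open_Compl)
qed

lemma isCont_radius: "x \<noteq> 0 \<Longrightarrow> isCont radius x"
  unfolding radius_def by (rule continuous_norm[OF isCont_radial_point])

text \<open>The tangent condition at \<open>w = radial_point M x\<close> confines the nearby points \<open>z\<close> of the surface to
  the outside of a double cone with axis \<open>x\<close> and vertex \<open>w\<close>: the radial part of \<open>z - w\<close> is at most
  \<open>q = cot \<beta>\<close> times its orthogonal part, for any \<open>\<beta> < \<alpha>\<close>. The radial part of \<open>z - w\<close> differs from the change of \<open>radius\<close> only to
  second order.\<close>

lemma radially_lipschitz_radius:
  assumes tangent: "tangent_condition \<alpha> M" and \<alpha>: "0 < \<alpha>" "\<alpha> \<le> pi / 2"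
  shows "radially_lipschitz (cos \<alpha> / sin \<alpha>) radius"
  unfolding radially_lipschitz_def
proof (intro allI impI conjI isCont_radius)
  fix x :: 'a and C assume x: "x \<noteq> 0" and C: "cos \<alpha> / sin \<alpha> < C"
  have sin\<alpha>: "sin \<alpha> > 0" using \<alpha> pi_gt_zero by (intro sin_gt_zero) auto
  have "((\<lambda>\<beta>. cos \<beta> / sin \<beta>) \<longlongrightarrow> cos \<alpha> / sin \<alpha>) (at_left \<alpha>)"
    using sin\<alpha> by (intro tendsto_intros) auto
  then have "eventually (\<lambda>\<beta>. cos \<beta> / sin \<beta> < C) (at_left \<alpha>)" using C by (rule order_tendstoD)
  moreover have "eventually (\<lambda>\<beta>. \<beta> \<in> {0<..<\<alpha>}) (at_left \<alpha>)"
    using \<alpha>(1) by (rule eventually_at_left_real)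
  ultimately have "eventually (\<lambda>\<beta>. cos \<beta> / sin \<beta> < C \<and> \<beta> \<in> {0<..<\<alpha>}) (at_left \<alpha>)"
    by (rule eventually_conj)
  then obtain \<beta> where \<beta>: "cos \<beta> / sin \<beta> < C" "0 < \<beta>" "\<beta> < \<alpha>"
    using eventually_happens'[OF trivial_limit_at_left_real] by force
  define q where "q = cos \<beta> / sin \<beta>"
  have sc: "sin \<beta> > 0" "cos \<beta> \<ge> 0" using \<beta> \<alpha> pi_gt_zero by (auto intro!: sin_gt_zero cos_ge_zero)
  then have q: "q \<ge> 0" by (simp add: q_def)
  define w where "w = radial_point M x"
  define r where "r = radius x"
  have r: "r > 0" using radius_pos x by (simp add: r_def)
  have w: "w \<in> M" "w = r *\<^sub>R sgn x"
    using radial_point_in radial_point_eq x by (auto simp: w_def r_def sgn_div_norm divide_inverse)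
  have sx: "norm (sgn x) = 1" "sgn x \<bullet> sgn x = 1"
    using x by (auto simp: norm_sgn simp flip: power2_norm_eq_inner)
  have "ereal \<beta> < Liminf (at w within M) (\<lambda>z. ereal (tangent_angle z w))"
    using tangent w(1) \<beta> unfolding tangent_condition_def by (meson ereal_less_eq less_ereal.simps(1) less_le_trans)
  then have "eventually (\<lambda>z. ereal \<beta> < ereal (tangent_angle z w)) (at w within M)"
    by (rule less_LiminfD)
  then obtain d where d: "d > 0" "\<And>z. z \<in> M \<Longrightarrow> z \<noteq> w \<Longrightarrow> dist z w < d \<Longrightarrow> \<beta> < tangent_angle z w"
    unfolding eventually_at by auto
  have cone: "\<bar>(z - w) \<bullet> sgn x\<bar> \<le> q * norm (perp x z)" if z: "z \<in> M" "dist z w < d" for z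
  proof (cases "z = w")
    case True
    then show ?thesis using q by simp
  next
    case False
    define a where "a = (z - w) \<bullet> sgn x"
    define b where "b = norm (perp x z)"
    have "perp x w = 0" using x by (simp add: w(2) perp_def sx)
    then have ab: "(norm (z - w))\<^sup>2 = a\<^sup>2 + b\<^sup>2"
      using norm_sq_perp[OF x, of "z - w"] by (simp add: a_def b_def perp_diff)
    define c where "c = \<bar>(z - w) \<bullet> w\<bar> / (norm (z - w) * norm w)"
    have w0: "norm w = r" using r sx by (simp add: w)
    have c01: "0 \<le> c" "c \<le> 1" unfolding c_def
      using Cauchy_Schwarz_ineq2[of "z - w" w] by (auto simp: divide_le_eq_1)
    have "\<beta> < arccos c" using d(2)[OF z(1) False z(2)] by (simp add: tangent_angle_def c_def)
    then have "cos (arccos c) \<le> cos \<beta>"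
      using c01 \<beta> \<alpha> by (intro cos_monotone_0_pi_le) (auto intro: arccos_ubound)
    then have "c \<le> cos \<beta>" using c01 by simp
    moreover have "c = \<bar>a\<bar> / norm (z - w)" using r by (simp add: c_def w0) (simp add: w a_def abs_mult)
    ultimately have "\<bar>a\<bar> \<le> cos \<beta> * norm (z - w)" using False by (simp add: divide_le_eq)
    then have "\<bar>a\<bar>\<^sup>2 \<le> (cos \<beta> * norm (z - w))\<^sup>2" by (intro power_mono) auto
    then have "a\<^sup>2 \<le> (cos \<beta>)\<^sup>2 * (a\<^sup>2 + b\<^sup>2)" by (simp add: power_mult_distrib ab)
    then have "(sin \<beta>)\<^sup>2 * a\<^sup>2 \<le> (cos \<beta>)\<^sup>2 * b\<^sup>2" by (simp add: sin_squared_eq algebra_simps)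
    then have "(sin \<beta> * \<bar>a\<bar>)\<^sup>2 \<le> (cos \<beta> * b)\<^sup>2" by (simp add: power_mult_distrib)
    then have "sin \<beta> * \<bar>a\<bar> \<le> cos \<beta> * b" by (rule power2_le_imp_le) (use sc in \<open>simp add: b_def\<close>)
    then show ?thesis using sc unfolding q_def a_def[symmetric] b_def[symmetric] by (simp add: field_simps)
  qed
  have "eventually (\<lambda>y. dist (radial_point M y) w < d) (at x)"
    using isCont_radial_point[OF x] d(1) by (auto simp: isCont_def tendsto_iff w_def)
  moreover have "eventually (\<lambda>y. y \<noteq> 0) (at x)"
    using x by (intro tendsto_imp_eventually_ne[OF tendsto_ident_at])
  moreover have "eventually (\<lambda>y. y \<bullet> sgn x > 0) (at x)"
  proof (rule order_tendstoD)
    show "((\<lambda>y. y \<bullet> sgn x) \<longlongrightarrow> x \<bullet> sgn x) (at x)" by (intro tendsto_intros)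
    show "0 < x \<bullet> sgn x" using x by (simp add: sgn_div_norm power2_norm_eq_inner[symmetric])
  qed
  moreover have "eventually (\<lambda>y. radius y / norm y * (q + norm (perp x y) / norm y) < C * (r / norm x)) (at x)"
  proof (rule order_tendstoD)
    show "((\<lambda>y. radius y / norm y * (q + norm (perp x y) / norm y)) \<longlongrightarrow>
            radius x / norm x * (q + norm (perp x x) / norm x)) (at x)"
      using isCont_radius[OF x] isCont_perp[of x x] x
      by (intro tendsto_intros) (auto simp: isCont_def)
    show "radius x / norm x * (q + norm (perp x x) / norm x) < C * (r / norm x)"
      using \<beta>(1) r x by (simp add: perp_self r_def[symmetric] q_def[symmetric] divide_strict_right_mono)
  qed
  ultimately show "eventually (\<lambda>y. \<bar>radius y - radius x\<bar> \<le> C * (radius x / norm x) * norm (perp x y)) (at x)"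
  proof eventually_elim
    case (elim y)
    define s where "s = radius y"
    \<comment> \<open>\<open>t\<close> and \<open>p / norm y\<close> are the cosine and the sine of the angle between \<open>x\<close> and \<open>y\<close>.\<close>
    define t where "t = (y \<bullet> sgn x) / norm y"
    define p where "p = norm (perp x y)"
    have s: "s > 0" using radius_pos elim by (simp add: s_def)
    have z: "radial_point M y = (s / norm y) *\<^sub>R y" using elim by (simp add: radial_point_eq s_def)
    have "\<bar>(radial_point M y - w) \<bullet> sgn x\<bar> \<le> q * norm (perp x (radial_point M y))"
      using elim radial_point_in by (intro cone) auto
    moreover have "(radial_point M y - w) \<bullet> sgn x = s * t - r"
      by (simp add: z w(2) inner_diff_left sx t_def)
    moreover have "norm (perp x (radial_point M y)) = s / norm y * p"
      using s by (simp add: z perp_scaleR p_def)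
    ultimately have 1: "\<bar>s * t - r\<bar> \<le> q * (s / norm y * p)" by simp
    have t: "t > 0" using elim by (simp add: t_def)
    have "t\<^sup>2 + (p / norm y)\<^sup>2 = ((y \<bullet> sgn x)\<^sup>2 + p\<^sup>2) / (norm y)\<^sup>2"
      by (simp add: t_def power_divide add_divide_distrib)
    also have "\<dots> = 1" using norm_sq_perp[OF x, of y] elim by (simp flip: p_def)
    finally have tp: "1 = t\<^sup>2 + (p / norm y)\<^sup>2" by simp
    then have "t\<^sup>2 \<le> 1" by (metis add_le_same_cancel1 le_add_same_cancel1 zero_le_power2)
    then have t1: "t \<le> 1" using power2_le_imp_le[of t 1] by simp
    then have "t\<^sup>2 \<le> t" using t by (simp add: power2_eq_square mult_left_le_one_le)
    then have "0 \<le> 1 - t" "1 - t \<le> (p / norm y)\<^sup>2" using tp t1 by auto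
    then have "\<bar>s - s * t\<bar> \<le> s * (p / norm y)\<^sup>2"
      using s by (simp add: right_diff_distrib[of s 1 t, simplified, symmetric] abs_mult)
    then have "\<bar>s - r\<bar> \<le> q * (s / norm y * p) + s * (p / norm y)\<^sup>2"
      using 1 by linarith
    also have "\<dots> = s / norm y * (q + p / norm y) * p"
      by (simp add: power2_eq_square algebra_simps)
    also have "\<dots> \<le> C * (r / norm x) * p"
      using elim by (intro mult_right_mono) (auto simp: p_def s_def)
    finally show ?case by (simp add: s_def r_def p_def)
  qed
qed

lemma radial_extension_bilipschitz:
  assumes tangent: "tangent_condition \<alpha> M" and \<alpha>: "0 < \<alpha>" "\<alpha> \<le> pi / 2"
    and L: "L = max ((SUP w\<in>M. norm w) / 2) (1 / (2 * (INF w\<in>M. norm w))) *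
               (sqrt ((1 / sin \<alpha>)\<^sup>2 - 1) + sqrt ((1 / sin \<alpha>)\<^sup>2 + 3))"
  shows "norm (radial_extension M x - radial_extension M y) \<le> L * norm (x - y)"
    and "norm (x - y) \<le> L * norm (radial_extension M x - radial_extension M y)"
proof -
  define k where "k = cos \<alpha> / sin \<alpha>"
  have "sin \<alpha> > 0" using \<alpha> pi_gt_zero by (intro sin_gt_zero) auto
  moreover have "cos \<alpha> \<ge> 0" using \<alpha> pi_gt_zero by (intro cos_ge_zero) auto
  ultimately have k: "k \<ge> 0" and "(1 / sin \<alpha>)\<^sup>2 = k\<^sup>2 + 1"
    by (auto simp: k_def cos_squared_eq field_simps)
  then have sh: "sqrt ((1 / sin \<alpha>)\<^sup>2 - 1) + sqrt ((1 / sin \<alpha>)\<^sup>2 + 3) = 2 * shear_norm k"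
    by (simp add: shear_norm_def)
  define R where "R = (SUP w\<in>M. norm w)"
  define r where "r = (INF w\<in>M. norm w)"
  obtain b :: 'a where "b \<noteq> 0" using nonzero_Basis nonempty_Basis by blast
  then have ne: "M \<noteq> {}" using radial_point_in by blast
  have cM: "compact (norm ` M)" using compact by (intro compact_continuous_image continuous_intros)
  then have R: "norm w \<le> R" if "w \<in> M" for w
    unfolding R_def using that by (intro cSUP_upper bounded_imp_bdd_above compact_imp_bounded)
  have r: "r \<le> norm w" if "w \<in> M" for w
    unfolding r_def using that cM by (intro cINF_lower bounded_imp_bdd_below compact_imp_bounded)
  have "r \<in> norm ` M" unfolding r_def using cM ne by (intro closed_contains_Inf)
      (auto intro: bounded_imp_bdd_below compact_imp_bounded compact_imp_closed)
  then have r0: "r > 0" using zero_notin by auto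
  have R0: "R \<ge> 0" using R ne norm_ge_zero order_trans by blast
  have sh1: "shear_norm k \<ge> 1" using shear_norm k by auto
  have L1: "R * shear_norm k \<le> L" and L2: "1 / r * shear_norm k \<le> L"
    using sh1 unfolding L sh R_def[symmetric] r_def[symmetric]
    by (auto simp: max_mult_distrib_right le_max_iff_disj)
  have rl: "radially_lipschitz k radius" unfolding k_def by (rule radially_lipschitz_radius[OF tangent \<alpha>])
  have up: "(R * shear_norm k)-lipschitz_on UNIV (\<lambda>x. radius x *\<^sub>R x)"
    using R0 R radial_point_in by (intro radial_map_lipschitz rl k radius_pos) (auto simp: radius_def)
  have lo: "(1 / r * shear_norm k)-lipschitz_on UNIV (\<lambda>x. (1 / radius x) *\<^sub>R x)"
  proof (intro radial_map_lipschitz radially_lipschitz_inverse rl k)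
    fix x :: 'a assume "x \<noteq> 0"
    then show "1 / radius x \<le> 1 / r"
      using r[OF radial_point_in] r0 by (intro divide_left_mono) (auto simp: radius_def intro!: mult_pos_pos radius_pos[unfolded radius_def])
  qed (use r0 radius_pos in auto)
  have inv: "(1 / radius (radial_extension M x)) *\<^sub>R radial_extension M x = x" for x
    using radius_pos[of x] by (cases "x = 0") (simp_all add: radial_extension_eq radius_scaleR)
  have "norm (radial_extension M x - radial_extension M y) \<le> R * shear_norm k * norm (x - y)"
    using lipschitz_onD[OF up, of x y] by (simp add: radial_extension_eq dist_norm)
  then show "norm (radial_extension M x - radial_extension M y) \<le> L * norm (x - y)"
    using mult_right_mono[OF L1 norm_ge_zero] by (rule order_trans)
  have "norm (x - y) \<le> 1 / r * shear_norm k * norm (radial_extension M x - radial_extension M y)"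
    using lipschitz_onD[OF lo, of "radial_extension M x" "radial_extension M y"]
    by (simp add: inv dist_norm)
  then show "norm (x - y) \<le> L * norm (radial_extension M x - radial_extension M y)"
    using mult_right_mono[OF L2 norm_ge_zero] by (rule order_trans)
qed

lemma quasi_inversion_involution: "quasi_inversion M (quasi_inversion M p) = p"
proof (cases p)
  case (Some x)
  show ?thesis
  proof (cases "x = 0")
    case False
    define c where "c = (radius x)\<^sup>2 / (norm x)\<^sup>2"
    have c: "c > 0" using radius_pos[OF False] False by (simp add: c_def)
    have "(radius x)\<^sup>2 / (norm (c *\<^sub>R x))\<^sup>2 * c = (radius x)\<^sup>2 / (norm x)\<^sup>2 / c"
      using c by (simp add: power_mult_distrib power2_eq_square)
    also have "\<dots> = 1" using c unfolding c_def[symmetric] by simp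
    finally have f0: "(radius x)\<^sup>2 / (norm (c *\<^sub>R x))\<^sup>2 * c = 1" .
    have f1: "quasi_inversion M (Some x) = Some (c *\<^sub>R x)" using False by (simp add: c_def radius_def)
    have f2: "quasi_inversion M (Some (c *\<^sub>R x)) =
        Some (((radius x)\<^sup>2 / (norm (c *\<^sub>R x))\<^sup>2 * c) *\<^sub>R x)"
      using False c radial_point_scaleR[OF c, of x] by (simp add: radius_def del: norm_scaleR)
    show ?thesis unfolding Some f1 f2 f0 by simp
  qed (simp add: Some)
qed simp

text \<open>The quasi-inversion is conjugate to the inversion in the unit sphere by the radial extension.\<close>

lemma quasi_inversion_conj:
  "quasi_inversion M (map_option (radial_extension M) p) = map_option (radial_extension M) (inversion p)"
proof (cases p)
  case (Some x)
  show ?thesis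
  proof (cases "x = 0")
    case False
    have n: "radius x > 0" "norm x > 0" using False radius_pos by auto
    have "radial_point M (radius x *\<^sub>R x) = radial_point M x"
      "radius (x /\<^sub>R (norm x)\<^sup>2) = radius x"
      using n by (auto intro!: radial_point_scaleR radius_scaleR)
    moreover have "(radius x)\<^sup>2 / (norm (radius x *\<^sub>R x))\<^sup>2 * radius x = radius x * inverse ((norm x)\<^sup>2)"
      using n by (simp add: power_mult_distrib divide_inverse)
    ultimately show ?thesis using False n Some
      by (simp add: radial_extension_eq radius_def[symmetric] del: norm_scaleR)
  qed (simp add: Some radial_extension_eq)
qed (simp add: radial_extension_eq)

lemma quasi_inversion_bilipschitz:
  assumes up: "\<And>x y. norm (radial_extension M x - radial_extension M y) \<le> C * norm (x - y)"
    and lo: "\<And>x y. norm (x - y) \<le> C * norm (radial_extension M x - radial_extension M y)"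
  shows "bilipschitz chordal (C ^ 6) (quasi_inversion M)"
proof (rule bilipschitz_chordal_involution[OF quasi_inversion_involution])
  let ?\<phi> = "radial_extension M" and ?\<psi> = "\<lambda>x. (1 / radius x) *\<^sub>R x"
  have \<phi>0: "?\<phi> 0 = 0" by (simp add: radial_extension_def)
  \<comment> \<open>Applied to a unit vector, the two bounds force \<open>1 \<le> C\<^sup>2\<close> and \<open>C > 0\<close>.\<close>
  obtain b :: 'a where b: "norm b = 1" using norm_Basis nonempty_Basis by blast
  have b1: "1 \<le> C * norm (?\<phi> b)" "norm (?\<phi> b) \<le> C" using up[of b 0] lo[of b 0] b by (auto simp: \<phi>0)
  have C: "C \<ge> 1"
  proof (rule ccontr)
    assume "\<not> C \<ge> 1"
    then have "norm (?\<phi> b) < 1" using b1 by simp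
    then have "C * norm (?\<phi> b) < 1" using \<open>\<not> C \<ge> 1\<close>
      by (smt (verit) mult_left_le norm_ge_zero mult_nonneg_nonneg mult_nonpos_nonneg)
    then show False using b1 by simp
  qed
  show "C ^ 6 > 0" using C by simp
  have \<phi>\<psi>: "?\<phi> (?\<psi> x) = x" for x
    using radius_pos[of x] by (cases "x = 0") (simp_all add: radial_extension_eq radius_scaleR)
  fix p q
  define p' q' where "p' = map_option ?\<psi> p" "q' = map_option ?\<psi> q"
  have pq: "p = map_option ?\<phi> p'" "q = map_option ?\<phi> q'"
    by (simp_all add: p'_q'_def option.map_comp o_def \<phi>\<psi> option.map_ident)
  have "chordal (quasi_inversion M p) (quasi_inversion M q) \<le> C ^ 3 * chordal p' q'"
    unfolding pq quasi_inversion_conj chordal_inversion[of p' q', symmetric]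
    using C up lo[of _ 0] by (intro chordal_map_option_le) (auto simp: \<phi>0)
  also have "chordal p' q' \<le> C ^ 3 * chordal p q"
    unfolding p'_q'_def
  proof (rule chordal_map_option_le[OF C])
    show "norm (?\<psi> x - ?\<psi> y) \<le> C * norm (x - y)" for x y using lo[of "?\<psi> x" "?\<psi> y"] unfolding \<phi>\<psi> .
    show "norm x \<le> C * norm (?\<psi> x)" for x using up[of "?\<psi> x" 0] unfolding \<phi>\<psi> \<phi>0 by simp
  qed
  finally show "chordal (quasi_inversion M p) (quasi_inversion M q) \<le> C ^ 6 * chordal p q"
    using C by (simp add: mult_left_mono flip: mult.assoc power_add)
qed

end

lemma star_surface_frontier:
  assumes "strictly_starlike D 0"
  shows "star_surface (frontier D)"
proof
  show "compact (frontier D)" using assms by (auto simp: strictly_starlike_def compact_frontier_bounded)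
  show "0 \<notin> frontier D" using assms by (auto simp: strictly_starlike_def frontier_def interior_open)
  show "\<exists>!w. w \<in> frontier D \<and> (\<exists>t>0. w = t *\<^sub>R u)" if "u \<noteq> 0" for u
    using assms that by (auto simp: strictly_starlike_def)
qed

section \<open>Surfaces close to the unit sphere\<close>

lemma has_derivative_imp_pointwise_lipschitz:
  assumes "(f has_derivative f') (at x)"
  shows "pointwise_lipschitz (onorm f') f x"
proof (rule pointwise_lipschitzI)
  fix C assume C: "onorm f' < C"
  have bl: "bounded_linear f'" using assms by (rule has_derivative_bounded_linear)
  obtain d where d: "d > 0" "\<And>y. norm (y - x) < d \<Longrightarrow>
      norm (f y - f x - f' (y - x)) \<le> (C - onorm f') * norm (y - x)"
    using assms C unfolding has_derivative_at_alt by (metis diff_gt_0_iff_gt)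
  have "norm (f y - f x) \<le> C * norm (y - x)" if "norm (y - x) < d" for y
    using d(2)[OF that] onorm[OF bl, of "y - x"] norm_triangle_sub[of "f y - f x" "f' (y - x)"]
    by (simp add: algebra_simps)
  then show "\<exists>d>0. \<forall>y. norm (y - x) < d \<longrightarrow> norm (f y - f x) \<le> C * norm (y - x)"
    using d(1) by blast
qed

lemma pointwise_lipschitz_homogeneous:
  assumes hom: "\<And>c x. c > 0 \<Longrightarrow> g (c *\<^sub>R x) = c *\<^sub>R g x" and g: "pointwise_lipschitz B g x" and c: "c > 0"
  shows "pointwise_lipschitz B g (c *\<^sub>R x)"
proof (rule pointwise_lipschitzI)
  fix C assume "B < C"
  then obtain d where d: "d > 0" "\<And>y. norm (y - x) < d \<Longrightarrow> norm (g y - g x) \<le> C * norm (y - x)"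
    using pointwise_lipschitzD[OF g] by blast
  show "\<exists>d>0. \<forall>y. norm (y - c *\<^sub>R x) < d \<longrightarrow> norm (g y - g (c *\<^sub>R x)) \<le> C * norm (y - c *\<^sub>R x)"
  proof (intro exI[of _ "c * d"] conjI allI impI)
    show "c * d > 0" using c d by simp
    fix y assume y: "norm (y - c *\<^sub>R x) < c * d"
    define z where "z = y /\<^sub>R c"
    have yz: "y = c *\<^sub>R z" using c by (simp add: z_def)
    have n: "norm (c *\<^sub>R a - c *\<^sub>R b) = c * norm (a - b)" for a b :: "'z::real_normed_vector"
      using c by (simp flip: scaleR_diff_right)
    have "norm (z - x) < d" using y c by (simp add: yz n)
    from mult_left_mono[OF d(2)[OF this], of c] c
    show "norm (g y - g (c *\<^sub>R x)) \<le> C * norm (y - c *\<^sub>R x)"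
      by (simp add: yz hom n mult_ac)
  qed
qed

text \<open>By the cone formula, the cone over a null set of the surface measure is a Lebesgue null set.\<close>

lemma AE_sphere_measure_imp_AE_cball:
  assumes "AE u in (sphere_measure :: 'a::euclidean_space measure). P u"
  shows "AE x in (lborel :: 'a measure). x \<in> cball 0 1 - {0} \<longrightarrow> P (x /\<^sub>R norm x)"
proof -
  let ?R = "restrict_space lborel (cball 0 1 - {0}) :: 'a measure"
  let ?S = "restrict_space borel (sphere 0 1) :: 'a measure"
  let ?D = "distr ?R ?S (\<lambda>x. x /\<^sub>R norm x)"
  have meas: "(\<lambda>x. x /\<^sub>R norm x) \<in> measurable ?R ?S"
  proof (rule measurable_restrict_space2)
    show "(\<lambda>x. x /\<^sub>R norm x) \<in> measurable ?R borel"
      by (rule measurable_restrict_space1) simp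
  qed (auto simp: space_restrict_space)
  obtain N where N: "{u \<in> space sphere_measure. \<not> P u} \<subseteq> N" "N \<in> null_sets (sphere_measure :: 'a measure)"
    using assms by (auto elim!: AE_E simp: null_sets_def)
  then have "of_nat DIM('a) * emeasure ?D N = 0" "N \<in> sets ?D"
    by (auto simp: sphere_measure_def null_sets_def)
  then have "N \<in> null_sets ?D" by (auto simp: null_sets_def)
  moreover have "{u \<in> space ?D. \<not> P u} \<subseteq> N"
    using N(1) by (simp add: sphere_measure_def space_scale_measure)
  ultimately have "AE u in ?D. P u" by (rule AE_I')
  then have "AE x in ?R. P (x /\<^sub>R norm x)" by (rule AE_distrD[OF meas])
  then show ?thesis by (subst (asm) AE_restrict_space_iff) auto
qed

context star_surface
begin

text \<open>The derivative of the positively homogeneous \<open>radial_extension M\<close> is constant on rays, so the bound on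
  the sphere spreads over the unit ball; homogeneity again extends the Lipschitz bound from the ball to
  the whole space. The constant \<open>K\<close> may be arbitrarily large and does not enter the conclusion.\<close>

lemma radial_extension_minus_id_lipschitz:
  assumes lip: "K-lipschitz_on UNIV (radial_extension M)" and e: "e > 0"
    and small: "esssup sphere_measure (deriv_deviation (radial_extension M) 1) < ereal e"
  shows "e-lipschitz_on UNIV (\<lambda>x. radial_extension M x - x)"
proof -
  define g where "g = (\<lambda>x. radial_extension M x - x)"
  have hom: "g (c *\<^sub>R x) = c *\<^sub>R g x" if "c > 0" for c x
    using that by (simp add: g_def radial_extension_scaleR scaleR_diff_right)
  have good: "pointwise_lipschitz e g u" if "deriv_deviation (radial_extension M) 1 u < ereal e" for u
  proof -
    define f' where "f' = frechet_derivative (radial_extension M) (at u)"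
    have diff: "radial_extension M differentiable (at u)" and "onorm (\<lambda>v. f' v - v) < e"
      using that by (auto simp: deriv_deviation_def f'_def split: if_splits)
    have "(g has_derivative (\<lambda>v. f' v - v)) (at u)"
      unfolding g_def f'_def using diff
      by (intro has_derivative_diff has_derivative_ident) (simp add: frechet_derivative_works)
    from has_derivative_imp_pointwise_lipschitz[OF this] \<open>onorm _ < e\<close>
    show ?thesis by (auto intro: pointwise_lipschitz_mono)
  qed
  have "AE u in sphere_measure. deriv_deviation (radial_extension M) 1 u < ereal e"
    using esssup_AE[of "deriv_deviation (radial_extension M) 1" sphere_measure]
    by (rule eventually_mono) (use small in \<open>auto intro: le_less_trans\<close>)
  then have "AE x in lborel. x \<in> cball 0 1 - {0} \<longrightarrow>
      deriv_deviation (radial_extension M) 1 (x /\<^sub>R norm x) < ereal e"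
    by (rule AE_sphere_measure_imp_AE_cball)
  moreover have "AE x in lborel. x \<noteq> (0::'a)" by (rule AE_lborel_singleton)
  ultimately have AE: "AE x in lborel. x \<in> ball 0 1 \<longrightarrow> pointwise_lipschitz e g x"
  proof eventually_elim
    case (elim x)
    show ?case
    proof
      assume "x \<in> ball 0 1"
      then have "pointwise_lipschitz e g (x /\<^sub>R norm x)" using elim by (intro good) auto
      then have "pointwise_lipschitz e g (norm x *\<^sub>R (x /\<^sub>R norm x))"
        by (rule pointwise_lipschitz_homogeneous[rotated]) (use elim hom in auto)
      moreover have "norm x *\<^sub>R (x /\<^sub>R norm x) = x" using elim by simp
      ultimately show "pointwise_lipschitz e g x" by simp
    qed
  qed
  have "(K + 1)-lipschitz_on UNIV g"
    unfolding g_def by (intro lipschitz_on_diff lip lipschitz_on_id[unfolded id_def])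
  from lipschitz_on_AE_pointwise[OF this _ _ _ AE] e have ball: "e-lipschitz_on (ball 0 1) g" by simp
  show ?thesis unfolding g_def[symmetric]
  proof (rule lipschitz_onI)
    fix x y :: 'a
    define c where "c = 1 / (norm x + norm y + 1)"
    have pos: "norm x + norm y + 1 > 0" by (simp add: add_nonneg_pos)
    then have c: "c > 0" by (simp add: c_def)
    have "c * norm x < 1" "c * norm y < 1" using pos by (auto simp: c_def pos_divide_less_eq add_nonneg_pos add_pos_nonneg)
    then have "dist (g (c *\<^sub>R x)) (g (c *\<^sub>R y)) \<le> e * dist (c *\<^sub>R x) (c *\<^sub>R y)"
      using c by (intro lipschitz_onD[OF ball]) auto
    moreover have "dist (c *\<^sub>R u) (c *\<^sub>R v) = c * dist u v" for u v :: 'a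
      using c by (simp add: dist_norm flip: scaleR_diff_right)
    ultimately show "dist (g x) (g y) \<le> e * dist x y"
      using c by (simp add: hom mult.left_commute[of e])
  qed (use e in simp)
qed

lemma bilipschitz_const_quasi_inversion_bounds:
  assumes lip: "K-lipschitz_on UNIV (radial_extension M)" and e: "0 < e" "e < 1"
    and small: "esssup sphere_measure (deriv_deviation (radial_extension M) 1) < ereal e"
  shows "1 \<le> bilipschitz_const chordal (quasi_inversion M)"
    and "bilipschitz_const chordal (quasi_inversion M) \<le> (1 / (1 - e)) ^ 6"
proof -
  let ?\<phi> = "radial_extension M"
  have near: "norm (?\<phi> x - ?\<phi> y - (x - y)) \<le> e * norm (x - y)" for x y
    using lipschitz_onD[OF radial_extension_minus_id_lipschitz[OF lip e(1) small], of x y]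
    by (simp add: dist_norm algebra_simps)
  have "bilipschitz chordal ((1 / (1 - e)) ^ 6) (quasi_inversion M)"
  proof (rule quasi_inversion_bilipschitz)
    fix x y
    have "(1 + e) * (1 - e) \<le> 1" by (simp add: algebra_simps)
    then have "1 + e \<le> 1 / (1 - e)" using e by (simp add: pos_le_divide_eq)
    have "norm (?\<phi> x - ?\<phi> y) \<le> (1 + e) * norm (x - y)"
      using near[of x y] norm_triangle_sub[of "?\<phi> x - ?\<phi> y" "x - y"] by (simp add: algebra_simps)
    also have "\<dots> \<le> 1 / (1 - e) * norm (x - y)"
      using \<open>1 + e \<le> _\<close> by (rule mult_right_mono) simp
    finally show "norm (?\<phi> x - ?\<phi> y) \<le> 1 / (1 - e) * norm (x - y)" .
    have "(1 - e) * norm (x - y) \<le> norm (?\<phi> x - ?\<phi> y)"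
      using near[of x y] norm_triangle_sub[of "x - y" "?\<phi> x - ?\<phi> y"]
      by (simp add: algebra_simps norm_minus_commute)
    then show "norm (x - y) \<le> 1 / (1 - e) * norm (?\<phi> x - ?\<phi> y)"
      using e by (simp add: pos_le_divide_eq mult.commute)
  qed
  from bilipschitz_const_chordal[OF this] bilipschitz_chordal_ge_1
  show "1 \<le> bilipschitz_const chordal (quasi_inversion M)"
    and "bilipschitz_const chordal (quasi_inversion M) \<le> (1 / (1 - e)) ^ 6" by blast+
qed

end

lemma bilipschitz_const_quasi_inversion_tendsto:
  fixes N :: "real \<Rightarrow> 'a::euclidean_space set"
  assumes N: "smoothly_converges N 1"
  shows "((\<lambda>t. bilipschitz_const chordal (quasi_inversion (N t))) \<longlongrightarrow> 1) (at 0 within {0..1})"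
proof -
  let ?b = "\<lambda>t. bilipschitz_const chordal (quasi_inversion (N t))"
  have bounds: "eventually (\<lambda>t. 1 \<le> ?b t \<and> ?b t \<le> (1 / (1 - e)) ^ 6) (at 0 within {0..1})"
    if e: "0 < e" "e < 1" for e
  proof -
    have "eventually (\<lambda>t. esssup sphere_measure (deriv_deviation (radial_extension (N t)) 1) < ereal e)
        (at 0 within {0..1})"
      using N e by (auto simp: smoothly_converges_def intro: order_tendstoD)
    moreover have "eventually (\<lambda>t. t \<in> {0..1}) (at (0::real) within {0..1})"
      by (simp add: eventually_at_filter)
    ultimately show ?thesis
    proof eventually_elim
      case (elim t)
      obtain D \<alpha> where D: "strictly_starlike D 0" "N t = frontier D" "0 < \<alpha>" "\<alpha> \<le> pi / 2"
          "tangent_condition \<alpha> (N t)"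
        using N elim(2) unfolding smoothly_converges_def by blast
      interpret star_surface "N t" unfolding D(2) by (rule star_surface_frontier[OF D(1)])
      define K where "K = max ((SUP w\<in>N t. norm w) / 2) (1 / (2 * (INF w\<in>N t. norm w))) *
               (sqrt ((1 / sin \<alpha>)\<^sup>2 - 1) + sqrt ((1 / sin \<alpha>)\<^sup>2 + 3))"
      have K: "norm (radial_extension (N t) x - radial_extension (N t) y) \<le> K * norm (x - y)" for x y
        by (rule radial_extension_bilipschitz[OF D(5,3,4) K_def])
      have "K \<ge> 0"
      proof -
        obtain b :: 'a where b: "norm b = 1" using norm_Basis nonempty_Basis by blast
        have "0 \<le> K * norm (b - 0)" using K[of b 0] norm_ge_zero order_trans by blast
        then show ?thesis using b by simp
      qed
      then have "K-lipschitz_on UNIV (radial_extension (N t))"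
        by (intro lipschitz_onI) (simp_all add: dist_norm K)
      then show ?case using bilipschitz_const_quasi_inversion_bounds[OF _ e elim(1)] by blast
    qed
  qed
  have lim: "((\<lambda>e::real. (1 / (1 - e)) ^ 6) \<longlongrightarrow> (1 / (1 - 0)) ^ 6) (at_right 0)"
    by (intro tendsto_intros) auto
  show ?thesis
  proof (rule order_tendstoI)
    fix a :: real assume "a < 1"
    have "eventually (\<lambda>t. 1 \<le> ?b t \<and> ?b t \<le> (1 / (1 - 1 / 2)) ^ 6) (at 0 within {0..1})"
      by (rule bounds) auto
    then show "eventually (\<lambda>t. a < ?b t) (at 0 within {0..1})"
      by (rule eventually_mono) (use \<open>a < 1\<close> in auto)
  next
    fix a :: real assume "1 < a"
    then have "eventually (\<lambda>e::real. (1 / (1 - e)) ^ 6 < a) (at_right 0)"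
      using order_tendstoD(2)[OF lim] by simp
    moreover have "eventually (\<lambda>e::real. e \<in> {0<..<1}) (at_right 0)"
      by (rule eventually_at_right_real) simp
    ultimately have "eventually (\<lambda>e::real. (1 / (1 - e)) ^ 6 < a \<and> e \<in> {0<..<1}) (at_right 0)"
      by (rule eventually_conj)
    then obtain e :: real where e: "(1 / (1 - e)) ^ 6 < a" "0 < e" "e < 1"
      using eventually_happens'[OF trivial_limit_at_right_real] by force
    from bounds[OF e(2,3)] show "eventually (\<lambda>t. ?b t < a) (at 0 within {0..1})"
      by (rule eventually_mono) (use e in auto)
  qed
qed

theorem theorem5p9:
  fixes D M :: "(real ^ 'n) set" and \<alpha> r_max r_min L :: real
  assumes "CARD('n) \<ge> 2"
    and "strictly_starlike D 0" and "M = frontier D"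
    and "0 < \<alpha>" and "\<alpha> \<le> pi / 2" and "tangent_condition \<alpha> M"
    and "r_max = (SUP w\<in>M. norm w)" and "r_min = (INF w\<in>M. norm w)"
    and "L = max (r_max / 2) (1 / (2 * r_min)) *
               (sqrt ((1 / sin \<alpha>)\<^sup>2 - 1) + sqrt ((1 / sin \<alpha>)\<^sup>2 + 3))"
  shows "bilipschitz chordal (L ^ 6) (quasi_inversion M) \<and>
         (\<forall>N :: real \<Rightarrow> (real ^ 'n) set. smoothly_converges N 1 \<longrightarrow>
            ((\<lambda>t. bilipschitz_const chordal (quasi_inversion (N t))) \<longlongrightarrow> 1)
              (at 0 within {0..1}))"
proof (intro conjI allI impI bilipschitz_const_quasi_inversion_tendsto)
  interpret star_surface M unfolding assms(3) by (rule star_surface_frontier[OF assms(2)])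
  show "bilipschitz chordal (L ^ 6) (quasi_inversion M)"
    using radial_extension_bilipschitz[OF assms(6,4,5) assms(9)[unfolded assms(7,8)]]
    by (intro quasi_inversion_bilipschitz)
qed

end
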